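(* Let $\mathcal H=\bigcup_{\ell\in\mathcal L}\mathcal H_\ell$ be the non-uniform inhomogeneous Erdős–Rényi hypergraph on $\mathcal V=[N]$ associated with symmetric probability tensors $\{Q^{(\ell)}\}_{\ell\in\mathcal L}$ (see context). For each $\ell\in\mathcal L$ put $\mathcal D^{(\ell)}_{\max}=\binom{N-1}{\ell-1}\max_{i_1,\dots,i_\ell\in\mathcal V}Q^{(\ell)}_{i_1,\dots,i_\ell}$, and $\mathcal D_{\max}=\sum_{\ell\in\mathcal L}\mathcal D^{(\ell)}_{\max}$. Suppose that for some constant $c>0$, $\mathcal D_{\max}\ge c\log N$. Then with probability at least $1-2N^{-10}-2e^{-N}$ the adjacency matrix $A$ of $\mathcal H$ satisfies $$\|A-\mathbb EA\|\le C\sqrt{\mathcal D_{\max}},$$ where $\|\cdot\|$ is the spectral norm, $C=10L_{\max}^2+2\beta$, $\beta=\beta_0\sqrt{\beta_1}+L_{\max}$, $\beta_0=16+32L_{\max}(1+e^2)+1792(1+e^{-2})L_{\max}^2$, and $\beta_1>L_{\max}$ is a constant satisfying $\frac{\beta_1}{L_{\max}}\log\frac{\beta_1}{L_{\max}}-\frac{\beta_1}{L_{\max}}+1>\frac{11}{c}$.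
   Context: $\mathcal L$ is a finite set of integers $\ge2$ with maximum element $L_{\max}$. For each $\ell\in\mathcal L$, $Q^{(\ell)}$ is a symmetric order-$\ell$ tensor with entries $Q^{(\ell)}_{i_1,\dots,i_\ell}\in[0,1]$, $i_1,\dots,i_\ell\in[N]$ (invariant under permutations of the indices). All hyperedges are independent: for each $\ell\in\mathcal L$ and each $\ell$-subset $e=\{i_1,\dots,i_\ell\}$ of $[N]$, $e$ is a hyperedge of $\mathcal H_\ell$ ($A^{(\ell)}_e=1$, otherwise $A^{(\ell)}_e=0$) with probability $Q^{(\ell)}_{i_1,\dots,i_\ell}$. The adjacency matrix is the $N\times N$ matrix $A_{ij}=\mathbf 1\{i\ne j\}\sum_{\ell\in\mathcal L}\sum_{e\supset\{i,j\},|e|=\ell}A^{(\ell)}_e$. *)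

theory Defs
  imports "HOL-Probability.Probability"
begin

text \<open>
  The vertex set is a finite type \<open>'n\<close>, so \<open>N = CARD('n)\<close>.
  An order-\<open>l\<close> tensor is a function on index lists; only lists of length \<open>l\<close> matter.
\<close>

definition symmetric_tensor :: "nat \<Rightarrow> ('n list \<Rightarrow> 'b) \<Rightarrow> bool" where
  "symmetric_tensor l T \<longleftrightarrow>
     (\<forall>xs ys. length xs = l \<and> mset ys = mset xs \<longrightarrow> T ys = T xs)"

text \<open>
  \<open>H l \<omega>\<close> is the edge set of the \<open>l\<close>-uniform layer. Hyperedges are independent within and
  across layers, hence the index set of pairs \<open>(l, e)\<close>. Tensor entries with repeated indices
  are constrained to \<open>[0,1]\<close> but do not affect the law of \<open>H\<close>.
\<close>

locale inhomogeneous_ER_hypergraph = prob_space M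
  for M :: "'w measure" +
  fixes L :: "nat set"
    and Q :: "nat \<Rightarrow> 'n::finite list \<Rightarrow> real"
    and H :: "nat \<Rightarrow> 'w \<Rightarrow> 'n set set"
  assumes finite_L: "finite L"
    and L_nonempty: "L \<noteq> {}"
    and L_ge_2: "\<And>l. l \<in> L \<Longrightarrow> 2 \<le> l"
    and Q_range: "\<And>l xs. l \<in> L \<Longrightarrow> length xs = l \<Longrightarrow> Q l xs \<in> {0..1}"
    and Q_symmetric: "\<And>l. l \<in> L \<Longrightarrow> symmetric_tensor l (Q l)"
    and H_uniform: "\<And>l \<omega> e. l \<in> L \<Longrightarrow> \<omega> \<in> space M \<Longrightarrow> e \<in> H l \<omega> \<Longrightarrow> card e = l"
    and H_indep: "indep_events (\<lambda>(l, e). {\<omega> \<in> space M. e \<in> H l \<omega>})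
                    (SIGMA l:L. {e. card e = l})"
    and H_prob: "\<And>l xs. l \<in> L \<Longrightarrow> length xs = l \<Longrightarrow> distinct xs \<Longrightarrow>
                    prob {\<omega> \<in> space M. set xs \<in> H l \<omega>} = Q l xs"

definition adjacency_matrix :: "nat set \<Rightarrow> (nat \<Rightarrow> 'w \<Rightarrow> 'n::finite set set) \<Rightarrow> 'w \<Rightarrow> real^'n^'n" where
  "adjacency_matrix L H \<omega> = (\<chi> i j. if i \<noteq> j
     then \<Sum>l\<in>L. \<Sum>e | card e = l \<and> {i, j} \<subseteq> e. of_bool (e \<in> H l \<omega>)
     else 0)"

definition matrix_expectation :: "'w measure \<Rightarrow> ('w \<Rightarrow> real^'n^'m) \<Rightarrow> real^'n^'m" where
  "matrix_expectation M X = (\<chi> i j. prob_space.expectation M (\<lambda>\<omega>. X \<omega> $ i $ j))"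

definition spectral_norm :: "real^'n^'m \<Rightarrow> real" where
  "spectral_norm B = onorm (\<lambda>x. B *v x)"

text \<open>The maximum runs over all index tuples, not only those with distinct entries.\<close>

definition layer_max_degree :: "(nat \<Rightarrow> 'n::finite list \<Rightarrow> real) \<Rightarrow> nat \<Rightarrow> real" where
  "layer_max_degree Q l =
     real ((CARD('n) - 1) choose (l - 1)) * Max (Q l ` {xs. length xs = l})"

definition total_max_degree :: "nat set \<Rightarrow> (nat \<Rightarrow> 'n::finite list \<Rightarrow> real) \<Rightarrow> real" where
  "total_max_degree L Q = (\<Sum>l\<in>L. layer_max_degree Q l)"

end

(*
  Kahn-Szemeredi argument. Up to a factor 2, the norm of W = A - EA is the maximum of |x . W x| over
  a 1/4-net of the sphere with at most 9^N points. For fixed x the light pairs, those with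
  |x_i x_j| <= sqrt D / N, contribute a sum of independent centred variables, one per hyperedge,
  with tails small enough for a union bound over the net. The heavy pairs are bounded
  deterministically for all x at once on the event that all row sums of A are O(D) and that the
  edge counts e(S,T) satisfy a discrepancy bound. The discrepancy bound is stated as a Chernoff
  bound with free exponent theta, which avoids the usual case distinction between sparse and dense
  pairs (S,T): theta is chosen separately for each pair of dyadic levels of x.
*)

theory Submission
  imports Defs
begin

section \<open>Dyadic sums\<close>

text \<open>The entries of A are dependent, since one hyperedge fills up to Lmax^2 positions. Every
  random sum is therefore regrouped by hyperedges, at the cost of powers of Lmax. The light
  threshold bounds the contribution of a hyperedge to the quadratic form by Lmax^2 sqrt D / N. Hence
  the exponent N / (Lmax^2 sqrt D) is admissible, and a deviation of 5 Lmax^2 sqrt D earns 5 N,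
  which beats the entropy N ln 9 of the net. Larger summands do not allow this exponent, so heavy
  pairs need bounds valid for all x at once. The obstacle there is the number of dyadic levels:
  bounding each pair of levels on its own would lose a factor growing with N. The estimates are
  arranged so that the sum over one level is geometric and the sum over the other is controlled by
  the total mass of x. The parts 10 Lmax^2 and 2 \<beta> of C are twice the light and the heavy
  bound. One N^(-10) pays for the row sums, one for the discrepancy, and 2 exp (- N) for the light
  pairs.\<close>

lemma sum_geometric_powi_le:
  fixes r c :: real and g :: "'a \<Rightarrow> int"
  assumes fin: "finite K" and inj: "inj_on g K" and r: "r > 1" and c: "c \<ge> 0"
    and le: "\<And>k. k \<in> K \<Longrightarrow> c * r powi g k \<le> 1"
  shows "(\<Sum>k\<in>K. c * r powi g k) \<le> r / (r - 1)"
proof (cases "K = {}")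
  case True
  then show ?thesis using r by simp
next
  case False
  \<comment> \<open>Counted downwards from the largest exponent, the distinct exponents become
    distinct powers of 1 / r, and the largest term is at most 1.\<close>
  define m where "m = Max (g ` K)"
  have m_in: "m \<in> g ` K" unfolding m_def using fin False by (intro Max_in) auto
  have m_ge: "g k \<le> m" if "k \<in> K" for k unfolding m_def using fin that by (intro Max_ge) auto
  have cm: "c * r powi m \<le> 1" using m_in le by auto
  have le_term: "c * r powi g k \<le> (1 / r) ^ nat (m - g k)" if "k \<in> K" for k
  proof -
    have "r powi m = r powi g k * r ^ nat (m - g k)"
      using m_ge[OF that] r by (simp flip: power_int_add power_int_of_nat)
    then have "c * r powi g k = c * r powi m * (1 / r) ^ nat (m - g k)"
      using r by (simp add: power_one_over)
    also have "\<dots> \<le> 1 * (1 / r) ^ nat (m - g k)"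
      using cm r by (intro mult_right_mono) auto
    finally show ?thesis by simp
  qed
  have inj': "inj_on (\<lambda>k. nat (m - g k)) K"
  proof (rule inj_onI)
    fix k l assume "k \<in> K" "l \<in> K" "nat (m - g k) = nat (m - g l)"
    then have "g k = g l" using m_ge[of k] m_ge[of l] by simp
    then show "k = l" using inj \<open>k \<in> K\<close> \<open>l \<in> K\<close> by (simp add: inj_on_eq_iff)
  qed
  have "(\<Sum>k\<in>K. c * r powi g k) \<le> (\<Sum>k\<in>K. (1 / r) ^ nat (m - g k))"
    by (intro sum_mono le_term)
  also have "\<dots> = (\<Sum>n\<in>(\<lambda>k. nat (m - g k)) ` K. (1 / r) ^ n)"
    by (subst sum.reindex[OF inj']) simp
  also have "\<dots> \<le> (\<Sum>n. (1 / r) ^ n)"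
    using r fin by (intro sum_le_suminf summable_geometric) auto
  also have "\<dots> = r / (r - 1)"
    using r by (subst suminf_geometric) (auto simp: field_simps)
  finally show ?thesis .
qed

text \<open>The concave function y ln (1 / y) - M y has its maximum exp (- M - 1) at y = exp (- M -
  1). With M close to ln s this trades the logarithm of the mass of a level for a multiple of the
  mass plus an error of order 1 / s, which is geometric over the levels.\<close>

lemma mult_ln_inverse_le:
  fixes y :: real
  assumes "y > 0"
  shows "y * ln (1 / y) \<le> M * y + exp (- M - 1)"
proof -
  have "ln (exp (- M - 1) / y) \<le> exp (- M - 1) / y - 1"
    using assms by (intro ln_le_minus_one) auto
  then have "y * (- M - 1 - ln y) \<le> y * (exp (- M - 1) / y - 1)"
    using assms by (intro mult_left_mono) (auto simp: ln_div)
  then show ?thesis using assms by (simp add: ln_div algebra_simps)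
qed

lemma one_plus_ln_le_two_sqrt:
  fixes \<rho> :: real
  assumes "\<rho> > 0"
  shows "1 + ln \<rho> \<le> 2 * sqrt \<rho>"
proof -
  have "ln (sqrt \<rho>) \<le> sqrt \<rho> - 1" using assms by (intro ln_le_minus_one) auto
  then show ?thesis using assms by (simp add: ln_sqrt)
qed

text \<open>
  Contribution of one dyadic level \<open>q = 2 ^ m\<close> of mass \<open>y\<close>, paired with all levels
  \<open>2 ^ k\<close> that are heavy but not too unbalanced against it. Put \<open>\<sigma> = 2 ^ k * q / sqrt D\<close> and let
  \<open>s\<close> be its largest possible value; with \<open>\<rho> = s / \<sigma>\<close> one has
  \<open>1 + ln s \<le> (1 + ln \<sigma>) * (1 + ln \<rho>)\<close>, so all denominators can be replaced by
  \<open>1 + ln s\<close> and the factor \<open>1 + ln \<rho>\<close> is absorbed by the geometric decay in \<open>k\<close>.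
  What remains is \<open>y * ln (1 / y)\<close>, which \<open>1 + ln s\<close> dominates up to a summable error.
\<close>

lemma level_sum_le:
  fixes D \<beta> B q y :: real
  assumes fin: "finite K" and D: "D > 0" and \<beta>: "\<beta> \<ge> 1" and B: "B = sqrt (\<beta> * D)"
    and q: "q > 0" and y: "y > 0" and yq: "y \<le> q\<^sup>2"
    and big: "\<And>k. k \<in> K \<Longrightarrow> 2 powi k * q > sqrt D"
    and small: "\<And>k. k \<in> K \<Longrightarrow> 2 powi k < 2 * B * q"
    and ne: "K \<noteq> {}"
  shows "2 * sqrt \<beta> * q\<^sup>2 > 1"
    and "(\<Sum>k\<in>K. y * (2 powi k / q) * (1 + ln (q\<^sup>2 / y)) / (1 + ln (2 powi k * q / sqrt D)))
           \<le> 14 * B * (2 * y + 1 / (2 * sqrt \<beta> * q\<^sup>2))"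
proof -
  have Bpos: "B > 0" using B D \<beta> by simp
  define s where "s = 2 * sqrt \<beta> * q\<^sup>2"
  define M where "M = 1 + ln s"
  \<comment> \<open>\<open>s\<close> is the value of \<open>\<sigma>\<close> at the excluded
    endpoint 2 ^ k = 2 * B * q of \<open>small\<close>.\<close>
  have s_eq: "s * sqrt D = 2 * B * q * q"
    unfolding s_def B by (simp add: real_sqrt_mult power2_eq_square)
  obtain k0 where k0: "k0 \<in> K" using ne by auto
  have "sqrt D < 2 powi k0 * q" using big[OF k0] .
  also have "\<dots> \<le> 2 * B * q * q" using small[OF k0] q by (intro mult_right_mono) auto
  also have "\<dots> = s * sqrt D" using s_eq by simp
  finally have s1: "s > 1" using D by simp
  then show "2 * sqrt \<beta> * q\<^sup>2 > 1" by (simp add: s_def)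
  have M1: "M \<ge> 1" using s1 by (simp add: M_def)
  define X where "X = y * (1 + ln (q\<^sup>2 / y))"
  have ln0: "ln (q\<^sup>2 / y) \<ge> 0" using y yq by simp
  have X0: "X \<ge> 0" unfolding X_def using y ln0 by simp
  have le_term: "y * (2 powi k / q) * (1 + ln (q\<^sup>2 / y)) / (1 + ln (2 powi k * q / sqrt D))
      \<le> X * (4 * B / M) * (1 / sqrt (2 * B * q) * sqrt 2 powi k)" if k: "k \<in> K" for k
  proof -
    define p :: real where "p = 2 powi k"
    have p: "p > 0" by (simp add: p_def)
    define u where "u = 1 + ln (p * q / sqrt D)"
    define \<rho> where "\<rho> = 2 * B * q / p"
    have \<rho>1: "\<rho> > 1" using small[OF k] p by (simp add: \<rho>_def p_def)
    have u1: "u \<ge> 1" using big[OF k] D by (simp add: u_def p_def)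
    have "s = p * q / sqrt D * \<rho>"
      using s_eq D p unfolding \<rho>_def by (simp add: field_simps)
    then have Mu: "M = u + ln \<rho>"
      unfolding M_def u_def using \<rho>1 p q D ln_mult_pos[of "p * q / sqrt D" \<rho>] by simp
    have "M \<le> u * (1 + ln \<rho>)"
      using u1 \<rho>1 Mu mult_right_mono[of 1 u "ln \<rho>"] by (simp add: algebra_simps)
    \<comment> \<open>Weakening the logarithm to a square root turns the factor 2 ^ k into a
      multiple of sqrt 2 ^ k, whose sum is still geometric.\<close>
    also have "\<dots> \<le> u * (2 * sqrt \<rho>)"
      using one_plus_ln_le_two_sqrt[of \<rho>] u1 \<rho>1 by (intro mult_left_mono) auto
    finally have inv_u: "1 / u \<le> 2 * sqrt \<rho> / M"
      using u1 M1 by (simp add: field_simps)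
    have sp: "sqrt 2 powi k = sqrt p"
    proof -
      have "(sqrt 2 powi k)\<^sup>2 = p"
        unfolding p_def power2_eq_square by (simp flip: power_int_mult_distrib)
      then show ?thesis by (intro real_sqrt_unique[symmetric]) auto
    qed
    have pq: "p / q * (2 * sqrt \<rho>) = 4 * B * (1 / sqrt (2 * B * q) * sqrt p)"
    proof -
      have sB: "sqrt (2 * B * q) * sqrt (2 * B * q) = 2 * B * q" using Bpos q by simp
      have sq: "sqrt p * sqrt p = p" using p by simp
      have pos: "sqrt (2 * B * q) > 0" "sqrt p > 0" using Bpos q p by auto
      define z where "z = sqrt (2 * B * q)"
      have "p / q * (2 * sqrt \<rho>) = 2 * (sqrt p * sqrt p) * (z / sqrt p) / q"
        unfolding \<rho>_def z_def sq by (simp add: real_sqrt_divide mult_ac)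
      also have "\<dots> = 2 * (z * z) * sqrt p / (q * z)"
        using pos q by (simp add: z_def[symmetric] field_simps)
      also have "\<dots> = 4 * B * (1 / z * sqrt p)"
        using sB q pos by (simp add: z_def[symmetric])
      finally have "p / q * (2 * sqrt \<rho>) = 4 * B * (1 / sqrt (2 * B * q) * sqrt p)"
        by (simp only: z_def)
      then show ?thesis .
    qed
    have "y * (p / q) * (1 + ln (q\<^sup>2 / y)) / u = X * (p / q) * (1 / u)"
      by (simp add: X_def)
    also have "\<dots> \<le> X * (p / q) * (2 * sqrt \<rho> / M)"
      using inv_u X0 p q by (intro mult_left_mono) auto
    also have "\<dots> = X * (p / q * (2 * sqrt \<rho>)) / M" by simp
    also have "\<dots> = X * (4 * B / M) * (1 / sqrt (2 * B * q) * sqrt p)"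
      unfolding pq by (simp add: mult_ac)
    finally show ?thesis unfolding sp u_def p_def .
  qed
  have geo: "(\<Sum>k\<in>K. 1 / sqrt (2 * B * q) * sqrt 2 powi k) \<le> sqrt 2 / (sqrt 2 - 1)"
  proof (rule sum_geometric_powi_le[of K "\<lambda>k. k"])
    fix k assume k: "k \<in> K"
    have "(sqrt 2 powi k)\<^sup>2 = 2 powi k"
      unfolding power2_eq_square by (simp flip: power_int_mult_distrib)
    then have "(sqrt 2 powi k)\<^sup>2 \<le> 2 * B * q" using small[OF k] by simp
    then have "sqrt 2 powi k \<le> sqrt (2 * B * q)" by (rule real_le_rsqrt)
    then show "1 / sqrt (2 * B * q) * sqrt 2 powi k \<le> 1"
      using Bpos q by (simp add: field_simps)
  qed (use fin Bpos q in auto)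
  \<comment> \<open>The exact value is about 3.41; rounding it to 7 / 2 gives the constant 14 = 4 *
    7 / 2.\<close>
  have s2: "sqrt 2 / (sqrt 2 - 1) \<le> (7 / 2 :: real)"
  proof -
    have "(7 / 5 :: real) \<le> sqrt 2" by (rule real_le_rsqrt) (simp add: power2_eq_square)
    then show ?thesis by (simp add: field_simps)
  qed
  have "(\<Sum>k\<in>K. y * (2 powi k / q) * (1 + ln (q\<^sup>2 / y)) / (1 + ln (2 powi k * q / sqrt D)))
      \<le> (\<Sum>k\<in>K. X * (4 * B / M) * (1 / sqrt (2 * B * q) * sqrt 2 powi k))"
    by (intro sum_mono le_term)
  also have "\<dots> = X * (4 * B / M) * (\<Sum>k\<in>K. 1 / sqrt (2 * B * q) * sqrt 2 powi k)"
    by (simp add: sum_distrib_left)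
  also have "\<dots> \<le> X * (4 * B / M) * (7 / 2)"
    using X0 Bpos M1 by (intro mult_left_mono[OF order_trans[OF geo s2]]) auto
  also have "\<dots> = 14 * B * (X / M)" by simp
  also have "\<dots> \<le> 14 * B * (2 * y + 1 / s)"
  proof (rule mult_left_mono)
    have "1 + ln (q\<^sup>2 / y) \<le> M + ln (1 / y)"
    proof -
      have "q\<^sup>2 \<le> s" unfolding s_def using real_sqrt_ge_one[OF \<beta>] zero_le_power2[of q]
          mult_right_mono[of 1 "2 * sqrt \<beta>" "q\<^sup>2"] by linarith
      then have "ln (q\<^sup>2) \<le> ln s" using q s1 by (subst ln_le_cancel_iff) auto
      then show ?thesis using q y by (simp add: M_def ln_div)
    qed
    then have "X \<le> y * M + y * ln (1 / y)"
      unfolding X_def using mult_left_mono[of _ _ y] y by (fastforce simp: algebra_simps)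
    also have "\<dots> \<le> 2 * y * M + exp (- M - 1)"
      using mult_ln_inverse_le[OF y, of M] by (simp add: algebra_simps)
    also have "exp (- M - 1) \<le> 1 / s"
    proof -
      have "exp (- M - 1) = exp (- 2) * (1 / s)"
        unfolding M_def using s1 by (simp add: exp_diff exp_minus field_simps flip: exp_add)
      also have "\<dots> \<le> 1 * (1 / s)" using s1 by (intro mult_right_mono) auto
      finally show ?thesis by simp
    qed
    also have "2 * y * M + 1 / s \<le> (2 * y + 1 / s) * M"
      using M1 s1 mult_left_mono[of 1 M "1/s"] by (simp add: algebra_simps)
    finally show "X / M \<le> 2 * y + 1 / s" using M1 by (simp add: field_simps)
  qed (use Bpos in auto)
  finally show "(\<Sum>k\<in>K. y * (2 powi k / q) * (1 + ln (q\<^sup>2 / y)) / (1 + ln (2 powi k * q / sqrt D)))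
           \<le> 14 * B * (2 * y + 1 / (2 * sqrt \<beta> * q\<^sup>2))" by (simp add: s_def)
qed

section \<open>Heavy pairs\<close>

text \<open>Logarithm of the usual upper bound \<open>(e * n / s) ^ s\<close> for \<open>n choose s\<close>.\<close>

definition set_cost :: "real \<Rightarrow> real \<Rightarrow> real" where
  "set_cost n s = s * (1 + ln (n / s))"

text \<open>
  Pairs with \<open>a i \<ge> B * a j\<close> are handled by the row sums. The others are sorted into dyadic
  levels, and \<open>disc\<close> is applied to each pair of levels with \<open>\<theta> = 1 + ln \<sigma>\<close>, the choice that makes
  its first term proportional to \<open>\<sigma>\<close>.
\<close>

lemma heavy_sum_le:
  fixes A :: "'n::finite \<Rightarrow> 'n \<Rightarrow> real" and a :: "'n \<Rightarrow> real" and N D \<beta> l B :: real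
  defines "N \<equiv> real CARD('n)"
  assumes A0: "\<And>i j. A i j \<ge> 0" and A_sym: "\<And>i j. A i j = A j i"
    and a0: "\<And>i. a i \<ge> 0" and a1: "(\<Sum>i\<in>UNIV. (a i)\<^sup>2) = 1"
    and D: "D > 0" and \<beta>: "\<beta> \<ge> 1" and l: "l \<ge> 1" and B: "B = sqrt (\<beta> * D)"
    and rows: "\<And>i. (\<Sum>j\<in>UNIV. A i j) \<le> \<beta> * D"
    and disc: "\<And>S T \<theta>. S \<noteq> {} \<Longrightarrow> T \<noteq> {} \<Longrightarrow> \<theta> > 0 \<Longrightarrow>
      \<theta> * (\<Sum>i\<in>S. \<Sum>j\<in>T. A i j)
        \<le> l * D / N * real (card S) * real (card T) * (exp \<theta> - 1)
          + 7 * l\<^sup>2 * (set_cost N (card S) + set_cost N (card T))"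
  shows "(\<Sum>(i, j) | a i * a j > sqrt D / N. A i j * a i * a j)
           \<le> (2 + 16 * exp 1 * l + 5488 / 3 * l\<^sup>2) * B"
proof -
  have N1: "N \<ge> 1" unfolding N_def by (simp add: Suc_leI)
  have Npos: "N > 0" using N1 by simp
  have Bpos: "B > 0" using B D \<beta> by simp
  have B2: "B * B = \<beta> * D" using B D \<beta> by simp
  define H where "H = {(i, j). a i * a j > sqrt D / N}"
  define R where "R = {(i, j) \<in> H. a i < B * a j \<and> a j < B * a i}"
  define f where "f = (\<lambda>(i, j). A i j * a i * a j)"
  have f0: "f z \<ge> 0" for z using A0 a0 by (cases z) (auto simp: f_def)

  \<comment> \<open>Replacing the smaller factor \<open>a j\<close> by \<open>a i / B\<close> leaves
    row sums weighted by \<open>(a i)\<^sup>2 / B\<close>, and \<beta> D / B = B.\<close>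
  have unbalanced: "(\<Sum>(i, j) | a i \<ge> B * a j. A i j * a i * a j) \<le> B"
  proof -
    have "(\<Sum>(i, j) | a i \<ge> B * a j. A i j * a i * a j) \<le> (\<Sum>(i, j) | a i \<ge> B * a j. A i j * (a i)\<^sup>2 / B)"
    proof (rule sum_mono, clarsimp)
      fix i j assume "B * a j \<le> a i"
      then have "a j \<le> a i / B" using Bpos by (simp add: field_simps)
      then have "A i j * a i * a j \<le> A i j * a i * (a i / B)"
        using A0 a0 by (intro mult_left_mono) auto
      then show "A i j * a i * a j \<le> A i j * (a i)\<^sup>2 / B" by (simp add: power2_eq_square)
    qed
    also have "\<dots> \<le> (\<Sum>(i, j)\<in>UNIV \<times> UNIV. A i j * (a i)\<^sup>2 / B)"
      using A0 Bpos by (intro sum_mono2) auto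
    also have "\<dots> = (\<Sum>i\<in>UNIV. (\<Sum>j\<in>UNIV. A i j) * ((a i)\<^sup>2 / B))"
      by (simp add: sum.cartesian_product[symmetric] sum_distrib_right sum_divide_distrib del: UNIV_Times_UNIV)
    also have "\<dots> \<le> (\<Sum>i\<in>UNIV. (\<beta> * D) * ((a i)\<^sup>2 / B))"
      using rows Bpos by (intro sum_mono mult_right_mono) auto
    also have "\<dots> = \<beta> * D / B * (\<Sum>i\<in>UNIV. (a i)\<^sup>2)"
      by (simp add: sum_distrib_left)
    also have "\<dots> = B" using a1 B2 Bpos by (simp add: field_simps)
    finally show ?thesis .
  qed
  have unbalanced': "(\<Sum>(i, j) | a j \<ge> B * a i. A i j * a i * a j) \<le> B"
  proof -
    have "(\<Sum>(i, j) | a j \<ge> B * a i. A i j * a i * a j) = (\<Sum>(i, j) | a i \<ge> B * a j. A i j * a i * a j)"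
      by (rule sum.reindex_bij_witness[of _ prod.swap prod.swap]) (auto simp: A_sym mult_ac)
    with unbalanced show ?thesis by simp
  qed

  define V where "V = {i. a i \<noteq> 0}"
  \<comment> \<open>Scaling by sqrt N puts a flat unit vector at level 0. Rounding upwards preserves
    heaviness for the level values; the price is the factor 2 in the balance conditions of
    \<open>P\<close> and the bound 4 for the total mass.\<close>
  define lev where "lev = (\<lambda>i. \<lceil>log 2 (a i * sqrt N)\<rceil>)"
  define p :: "int \<Rightarrow> real" where "p = (\<lambda>k. 2 powi k)"
  have p0: "p k > 0" for k by (simp add: p_def)
  have lev_upper: "a i * sqrt N \<le> p (lev i)" and lev_lower: "p (lev i) < 2 * (a i * sqrt N)"
    if "i \<in> V" for i
  proof -
    define t where "t = a i * sqrt N"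
    have t: "t > 0" unfolding t_def using that a0[of i] Npos by (simp add: V_def less_le)
    have pr: "p k = 2 powr of_int k" for k by (simp add: p_def powr_real_of_int')
    have "t = 2 powr (log 2 t)" using t by simp
    also have "\<dots> \<le> 2 powr of_int \<lceil>log 2 t\<rceil>" by (intro powr_mono) auto
    finally show "a i * sqrt N \<le> p (lev i)" by (simp add: pr lev_def t_def)
    have "2 powr of_int \<lceil>log 2 t\<rceil> < 2 powr (log 2 t + 1)"
      by (intro powr_less_mono) linarith+
    also have "\<dots> = 2 * t" using t by (simp add: powr_add)
    finally show "p (lev i) < 2 * (a i * sqrt N)" by (simp add: pr lev_def t_def)
  qed
  define K where "K = lev ` V"
  define S where "S = (\<lambda>k. {i \<in> V. lev i = k})"
  define s where "s = (\<lambda>k. real (card (S k)))"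
  define \<mu> where "\<mu> = (\<lambda>k. s k * (p k)\<^sup>2 / N)"
  have finK: "finite K" by (simp add: K_def)
  have S_ne: "S k \<noteq> {}" if "k \<in> K" for k using that by (auto simp: K_def S_def)
  have s1: "s k \<ge> 1" if "k \<in> K" for k
    using S_ne[OF that] by (simp add: s_def Suc_le_eq card_gt_0_iff)
  have sN: "s k \<le> N" for k unfolding s_def N_def by (intro of_nat_mono card_mono) auto
  have \<mu>0: "\<mu> k > 0" if "k \<in> K" for k
    unfolding \<mu>_def using s1[OF that] p0[of k] Npos by simp
  have \<mu>0': "\<mu> k \<ge> 0" for k
    unfolding \<mu>_def s_def using Npos by simp
  have \<mu>_sum: "(\<Sum>k\<in>K. \<mu> k) \<le> 4"
  proof -
    have "\<mu> k \<le> (\<Sum>i\<in>S k. 4 * (a i)\<^sup>2)" for k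
    proof -
      have "\<mu> k = (\<Sum>i\<in>S k. (p k)\<^sup>2 / N)" by (simp add: \<mu>_def s_def)
      also have "\<dots> \<le> (\<Sum>i\<in>S k. 4 * (a i)\<^sup>2)"
      proof (rule sum_mono)
        fix i assume "i \<in> S k"
        then have i: "i \<in> V" "lev i = k" by (auto simp: S_def)
        have "(p k)\<^sup>2 \<le> (2 * (a i * sqrt N))\<^sup>2"
          using lev_lower[OF i(1)] i(2) p0[of k] by (intro power_mono) auto
        also have "\<dots> = 4 * (a i)\<^sup>2 * N" using Npos by (simp add: power_mult_distrib)
        finally show "(p k)\<^sup>2 / N \<le> 4 * (a i)\<^sup>2" using Npos by (simp add: field_simps)
      qed
      finally show ?thesis .
    qed
    then have "(\<Sum>k\<in>K. \<mu> k) \<le> (\<Sum>k\<in>K. \<Sum>i\<in>S k. 4 * (a i)\<^sup>2)" by (intro sum_mono)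
    also have "\<dots> = (\<Sum>i\<in>V. 4 * (a i)\<^sup>2)"
      unfolding S_def by (rule sum.group) (auto simp: K_def)
    also have "\<dots> \<le> (\<Sum>i\<in>UNIV. 4 * (a i)\<^sup>2)" by (intro sum_mono2) auto
    also have "\<dots> = 4" using a1 by (simp flip: sum_distrib_left)
    finally show ?thesis .
  qed

  define P where "P = {(k, m) \<in> K \<times> K. p k * p m > sqrt D \<and> p k < 2 * B * p m \<and> p m < 2 * B * p k}"
  have finP: "finite P" by (rule finite_subset[of _ "K \<times> K"]) (use finK in \<open>auto simp: P_def\<close>)
  define e where "e = (\<lambda>k m. \<Sum>i\<in>S k. \<Sum>j\<in>S m. A i j)"
  have balanced: "(\<Sum>z\<in>R. f z) \<le> (\<Sum>(k, m)\<in>P. e k m * (p k * p m / N))"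
  proof -
    define g where "g = (\<lambda>(i, j). (lev i, lev j))"
    have sqN: "sqrt N * sqrt N = N" using Npos by simp
    have RV: "i \<in> V" "j \<in> V" if "(i, j) \<in> R" for i j
      using that D Npos a0[of i] a0[of j] by (auto simp: R_def H_def V_def)
    have gP: "g ` R \<subseteq> P"
    proof
      fix z assume "z \<in> g ` R"
      then obtain i j where ij: "(i, j) \<in> R" and z: "z = (lev i, lev j)" by (auto simp: g_def)
      note V = RV[OF ij]
      have h: "a i * a j > sqrt D / N" "a i < B * a j" "a j < B * a i"
        using ij by (auto simp: R_def H_def)
      have "sqrt D < a i * a j * N" using h(1) Npos by (simp add: field_simps)
      also have "\<dots> = (a i * sqrt N) * (a j * sqrt N)"
        by (subst sqN[symmetric]) (simp add: mult_ac)
      also have "\<dots> \<le> p (lev i) * p (lev j)"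
        using lev_upper[OF V(1)] lev_upper[OF V(2)] a0 Npos p0 by (intro mult_mono) (auto simp: less_imp_le)
      finally have 1: "sqrt D < p (lev i) * p (lev j)" .
      have bal: "p (lev i) < 2 * B * p (lev j)" if "i \<in> V" "j \<in> V" "a i < B * a j" for i j
      proof -
        have "p (lev i) < 2 * (a i * sqrt N)" using lev_lower that by auto
        also have "\<dots> \<le> 2 * (B * a j * sqrt N)" using that Npos by simp
        also have "\<dots> \<le> 2 * B * p (lev j)" using lev_upper[OF that(2)] Bpos by (simp add: mult.assoc)
        finally show ?thesis .
      qed
      show "z \<in> P" using 1 bal[OF V h(2)] bal[OF V(2,1) h(3)] V by (auto simp: P_def z K_def)
    qed
    have "(\<Sum>z\<in>R. f z) = (\<Sum>q\<in>P. \<Sum>z | z \<in> R \<and> g z = q. f z)"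
      by (rule sum.group[symmetric]) (use finP gP in auto)
    also have "\<dots> \<le> (\<Sum>(k, m)\<in>P. e k m * (p k * p m / N))"
    proof (rule sum_mono, clarify)
      fix k m assume "(k, m) \<in> P"
      have "(\<Sum>z | z \<in> R \<and> g z = (k, m). f z) \<le> (\<Sum>z | z \<in> R \<and> g z = (k, m). (\<lambda>(i, j). A i j * (p k * p m / N)) z)"
      proof (rule sum_mono, clarify)
        fix i j assume ij: "(i, j) \<in> R" "g (i, j) = (k, m)"
        note V = RV[OF ij(1)]
        have "(a i * sqrt N) * (a j * sqrt N) \<le> p k * p m"
          using lev_upper[OF V(1)] lev_upper[OF V(2)] a0 Npos p0 ij(2)
          by (intro mult_mono) (auto simp: less_imp_le g_def)
        moreover have "(a i * sqrt N) * (a j * sqrt N) = a i * a j * N"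
          by (subst (3) sqN[symmetric]) (simp add: mult_ac)
        ultimately have "a i * a j * N \<le> p k * p m" by (simp only:)
        then have "a i * a j \<le> p k * p m / N" using Npos by (simp add: field_simps)
        then show "f (i, j) \<le> A i j * (p k * p m / N)"
          using mult_left_mono[of _ _ "A i j"] A0[of i j] unfolding f_def
          by (fastforce simp only: mult.assoc prod.case)
      qed
      also have "\<dots> \<le> (\<Sum>z\<in>S k \<times> S m. (\<lambda>(i, j). A i j * (p k * p m / N)) z)"
      proof (rule sum_mono2)
        show "{z. z \<in> R \<and> g z = (k, m)} \<subseteq> S k \<times> S m" using RV by (auto simp: g_def S_def)
      qed (use A0 p0 Npos in \<open>auto simp: less_imp_le\<close>)
      also have "\<dots> = e k m * (p k * p m / N)"
        unfolding e_def by (simp add: sum.cartesian_product sum_distrib_right sum_divide_distrib case_prod_unfold)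
      finally show "(\<Sum>z | z \<in> R \<and> g z = (k, m). f z) \<le> e k m * (p k * p m / N)" .
    qed
    finally show ?thesis .
  qed

  \<comment> \<open>Since \<open>(p m)\<^sup>2 / \<mu> m\<close> equals \<open>N / s m\<close>, this
    is \<open>set_cost N (s m)\<close> times \<open>p k * p m / N\<close> divided by
    \<open>\<theta>\<close>, brought into the shape of the summand of
    \<open>level_sum_le\<close>.\<close>
  define h where "h = (\<lambda>k m. \<mu> m * (p k / p m) * (1 + ln ((p m)\<^sup>2 / \<mu> m)) / (1 + ln (p k * p m / sqrt D)))"
  have pair_bound: "e k m * (p k * p m / N) \<le> exp 1 * l * sqrt D * (\<mu> k * \<mu> m) + 7 * l\<^sup>2 * (h k m + h m k)"
    if km: "(k, m) \<in> P" for k m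
  proof -
    have K: "k \<in> K" "m \<in> K" and big: "p k * p m > sqrt D" using km by (auto simp: P_def)
    define \<sigma> where "\<sigma> = p k * p m / sqrt D"
    define \<theta> where "\<theta> = 1 + ln \<sigma>"
    have \<sigma>: "\<sigma> > 1" using big D by (simp add: \<sigma>_def)
    have \<theta>: "\<theta> \<ge> 1" using \<sigma> by (simp add: \<theta>_def)
    \<comment> \<open>Multiplied by \<open>p k * p m\<close>, the factor \<open>\<sigma>\<close>
      becomes \<open>(p k * p m)\<^sup>2 / sqrt D\<close>, so the main term turns into a multiple of
      \<open>\<mu> k * \<mu> m\<close> free of logarithms.\<close>
    have exp_\<theta>: "exp \<theta> = exp 1 * \<sigma>" using \<sigma> by (simp add: \<theta>_def exp_add)
    have pp: "p k * p m = \<sigma> * sqrt D" using D by (simp add: \<sigma>_def)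
    have "\<theta> * e k m \<le> l * D / N * s k * s m * (exp \<theta> - 1) + 7 * l\<^sup>2 * (set_cost N (s k) + set_cost N (s m))"
      using disc[OF S_ne[OF K(1)] S_ne[OF K(2)], of \<theta>] \<theta> by (simp add: e_def s_def)
    also have "l * D / N * s k * s m * (exp \<theta> - 1) \<le> l * D / N * s k * s m * (exp 1 * \<sigma>)"
      using l D Npos s1[OF K(1)] s1[OF K(2)] by (intro mult_left_mono) (auto simp: exp_\<theta>)
    finally have "\<theta> * e k m * (p k * p m / N)
        \<le> (l * D / N * s k * s m * (exp 1 * \<sigma>) + 7 * l\<^sup>2 * (set_cost N (s k) + set_cost N (s m))) * (p k * p m / N)"
      using p0[of k] p0[of m] Npos by (intro mult_right_mono) auto
    also have "\<dots> = exp 1 * l * sqrt D * (\<mu> k * \<mu> m)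
        + 7 * l\<^sup>2 * (set_cost N (s k) * (p k * p m / N) + set_cost N (s m) * (p k * p m / N))"
    proof -
      have "l * D / N * s k * s m * (exp 1 * \<sigma>) * (p k * p m / N) = exp 1 * l * sqrt D * (\<mu> k * \<mu> m)"
      proof -
        have "\<mu> k * \<mu> m = s k * s m * (p k * p m) * (p k * p m) / (N * N)"
          by (simp add: \<mu>_def power2_eq_square)
        also have "\<dots> = s k * s m * (\<sigma> * sqrt D) * (p k * p m) / (N * N)" by (simp only: pp)
        finally have "sqrt D * (\<mu> k * \<mu> m) = (sqrt D * sqrt D) * (s k * s m * \<sigma> * (p k * p m) / (N * N))"
          by simp
        then have E: "D * (s k * s m * \<sigma> * (p k * p m) / (N * N)) = sqrt D * (\<mu> k * \<mu> m)" using D by simp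
        have "l * D / N * s k * s m * (exp 1 * \<sigma>) * (p k * p m / N)
            = exp 1 * l * (D * (s k * s m * \<sigma> * (p k * p m) / (N * N)))" by (simp add: mult_ac)
        then show ?thesis unfolding E by (simp add: mult_ac)
      qed
      then show ?thesis by (simp add: distrib_right distrib_left mult_ac)
    qed
    also have "set_cost N (s m) * (p k * p m / N) = \<theta> * h k m"
      using \<theta> p0[of k] p0[of m] Npos s1[OF K(2)]
      by (simp add: set_cost_def h_def \<sigma>_def[symmetric] \<theta>_def[symmetric] \<mu>_def power2_eq_square)
    also have "set_cost N (s k) * (p k * p m / N) = \<theta> * h m k"
      using \<theta> p0[of k] p0[of m] Npos s1[OF K(1)]
      by (simp add: set_cost_def h_def mult.commute[of "p m" "p k"] \<sigma>_def[symmetric] \<theta>_def[symmetric] \<mu>_def power2_eq_square)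
    finally have "\<theta> * (e k m * (p k * p m / N)) \<le> exp 1 * l * sqrt D * (\<mu> k * \<mu> m) + \<theta> * (7 * l\<^sup>2 * (h k m + h m k))"
      by (simp add: algebra_simps)
    \<comment> \<open>Because \<open>\<theta> \<ge> 1\<close>, the main term may acquire a factor
      \<open>\<theta>\<close>, which is then cancelled throughout.\<close>
    also have "exp 1 * l * sqrt D * (\<mu> k * \<mu> m) \<le> \<theta> * (exp 1 * l * sqrt D * (\<mu> k * \<mu> m))"
      using mult_right_mono[of 1 \<theta> "exp 1 * l * sqrt D * (\<mu> k * \<mu> m)"] \<theta> l D \<mu>0' by simp
    finally have "\<theta> * (e k m * (p k * p m / N)) \<le> \<theta> * (exp 1 * l * sqrt D * (\<mu> k * \<mu> m) + 7 * l\<^sup>2 * (h k m + h m k))"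
      by (simp add: distrib_left)
    then show ?thesis by (rule mult_left_le_imp_le) (use \<theta> in simp)
  qed

  have first: "(\<Sum>(k, m)\<in>P. \<mu> k * \<mu> m) \<le> 16"
  proof -
    have "(\<Sum>(k, m)\<in>P. \<mu> k * \<mu> m) \<le> (\<Sum>(k, m)\<in>K \<times> K. \<mu> k * \<mu> m)"
      using finK \<mu>0' by (intro sum_mono2) (auto simp: P_def)
    also have "\<dots> = (\<Sum>k\<in>K. \<mu> k) * (\<Sum>k\<in>K. \<mu> k)"
      by (simp add: sum.cartesian_product[symmetric] sum_product)
    also have "\<dots> \<le> 4 * 4" using \<mu>_sum \<mu>0' by (intro mult_mono sum_nonneg) auto
    finally show ?thesis by simp
  qed

  define Km where "Km = (\<lambda>m. {k \<in> K. (k, m) \<in> P})"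
  \<comment> \<open>The existence of a partner level forces
    \<open>2 * sqrt \<beta> * (p m)\<^sup>2 > 1\<close>. On such levels the error terms form a
    geometric series of ratio 4 with largest term below 1, hence the summand 4 / (4 - 1)
    below.\<close>
  define G where "G = {m \<in> K. Km m \<noteq> {}}"
  have second: "(\<Sum>(k, m)\<in>P. h k m) \<le> 14 * B * (28 / 3)"
  proof -
    have level: "2 * sqrt \<beta> * (p m)\<^sup>2 > 1"
        "(\<Sum>k\<in>Km m. h k m) \<le> 14 * B * (2 * \<mu> m + 1 / (2 * sqrt \<beta> * (p m)\<^sup>2))"
      if "m \<in> G" for m
    proof -
      have m: "m \<in> K" "Km m \<noteq> {}" using that by (auto simp: G_def)
      have "s m * (p m)\<^sup>2 \<le> N * (p m)\<^sup>2" using sN by (intro mult_right_mono) auto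
      then have "\<mu> m \<le> (p m)\<^sup>2" using Npos by (simp add: \<mu>_def field_simps)
      note * = level_sum_le[of "Km m" D \<beta> B "p m" "\<mu> m", OF _ D \<beta> B p0 \<mu>0[OF m(1)] this _ _ m(2)]
      show "2 * sqrt \<beta> * (p m)\<^sup>2 > 1"
        by (rule *(1)) (use finK in \<open>auto simp: Km_def P_def p_def\<close>)
      show "(\<Sum>k\<in>Km m. h k m) \<le> 14 * B * (2 * \<mu> m + 1 / (2 * sqrt \<beta> * (p m)\<^sup>2))"
        using *(2) finK by (auto simp: Km_def P_def p_def h_def)
    qed
    have "(\<Sum>(k, m)\<in>P. h k m) = (\<Sum>(m, k)\<in>Sigma G Km. h k m)"
      by (rule sum.reindex_bij_witness[of _ prod.swap prod.swap]) (auto simp: P_def Km_def G_def)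
    also have "\<dots> = (\<Sum>m\<in>G. \<Sum>k\<in>Km m. h k m)"
      using finK by (intro sum.Sigma[symmetric]) (auto simp: G_def Km_def)
    also have "\<dots> \<le> (\<Sum>m\<in>G. 14 * B * (2 * \<mu> m + 1 / (2 * sqrt \<beta> * (p m)\<^sup>2)))"
      by (intro sum_mono level)
    also have "\<dots> = 14 * B * (2 * (\<Sum>m\<in>G. \<mu> m) + (\<Sum>m\<in>G. 1 / (2 * sqrt \<beta> * (p m)\<^sup>2)))"
      by (simp only: sum_distrib_left[symmetric] sum.distrib)
    also have "\<dots> \<le> 14 * B * (2 * 4 + 4 / (4 - 1))"
    proof (intro mult_left_mono add_mono)
      have "(\<Sum>m\<in>G. \<mu> m) \<le> (\<Sum>m\<in>K. \<mu> m)"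
        using finK \<mu>0' by (intro sum_mono2) (auto simp: G_def)
      then show "(\<Sum>m\<in>G. \<mu> m) \<le> 4" using \<mu>_sum by simp
      have eq: "1 / (2 * sqrt \<beta> * (p m)\<^sup>2) = 1 / (2 * sqrt \<beta>) * 4 powi (- m)" for m
      proof -
        have "(p m)\<^sup>2 = 4 powi m"
          unfolding p_def power2_eq_square by (simp flip: power_int_mult_distrib)
        then show ?thesis by (simp add: power_int_minus field_simps)
      qed
      have "(\<Sum>m\<in>G. 1 / (2 * sqrt \<beta>) * 4 powi (- m)) \<le> (4::real) / (4 - 1)"
      proof (rule sum_geometric_powi_le)
        fix m assume "m \<in> G"
        then show "1 / (2 * sqrt \<beta>) * 4 powi (- m) \<le> 1"
          using level(1)[of m] unfolding eq[symmetric] by (simp add: field_simps)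
      qed (use finK \<beta> in \<open>auto simp: G_def inj_on_def\<close>)
      then show "(\<Sum>m\<in>G. 1 / (2 * sqrt \<beta> * (p m)\<^sup>2)) \<le> 4 / (4 - 1)" by (simp only: eq)
    qed (use Bpos in auto)
    finally show ?thesis by simp
  qed
  have second': "(\<Sum>(k, m)\<in>P. h m k) = (\<Sum>(k, m)\<in>P. h k m)"
    by (rule sum.reindex_bij_witness[of _ prod.swap prod.swap]) (auto simp: P_def mult.commute)

  have DB: "sqrt D \<le> B" unfolding B using D \<beta> by simp
  have "(\<Sum>z\<in>R. f z) \<le> (\<Sum>(k, m)\<in>P. exp 1 * l * sqrt D * (\<mu> k * \<mu> m) + 7 * l\<^sup>2 * (h k m + h m k))"
    by (rule order_trans[OF balanced sum_mono]) (use pair_bound in auto)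
  also have "\<dots> = exp 1 * l * sqrt D * (\<Sum>(k, m)\<in>P. \<mu> k * \<mu> m)
      + 7 * l\<^sup>2 * ((\<Sum>(k, m)\<in>P. h k m) + (\<Sum>(k, m)\<in>P. h m k))"
    by (simp add: sum_distrib_left sum.distrib case_prod_unfold distrib_left)
  \<comment> \<open>The coefficient 5488 / 3 is 7 * 2 * 14 * 28 / 3, where 28 / 3 = 2 * 4 + 4 /
    3.\<close>
  also have "\<dots> \<le> exp 1 * l * B * 16 + 7 * l\<^sup>2 * (14 * B * (28 / 3) + 14 * B * (28 / 3))"
    using first second second' DB l D Bpos \<mu>0'
    by (intro add_mono mult_mono mult_left_mono sum_nonneg) auto
  also have "\<dots> = (16 * exp 1 * l + 5488 / 3 * l\<^sup>2) * B" by (simp add: algebra_simps)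
  finally have R_bound: "(\<Sum>z\<in>R. f z) \<le> (16 * exp 1 * l + 5488 / 3 * l\<^sup>2) * B" .

  define U where "U = {(i, j). a i \<ge> B * a j}"
  define U' where "U' = {(i, j). a j \<ge> B * a i}"
  have "(\<Sum>(i, j) | a i * a j > sqrt D / N. A i j * a i * a j) = (\<Sum>z\<in>H. f z)"
    by (simp add: H_def f_def)
  also have "\<dots> \<le> (\<Sum>z\<in>R \<union> (U \<union> U'). f z)"
    using f0 by (intro sum_mono2) (auto simp: R_def U_def U'_def)
  also have "\<dots> \<le> (\<Sum>z\<in>R. f z) + ((\<Sum>z\<in>U. f z) + (\<Sum>z\<in>U'. f z))"
    using sum_Un[of R "U \<union> U'" f] sum_Un[of U U' f] sum_nonneg[of "R \<inter> (U \<union> U')" f]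
      sum_nonneg[of "U \<inter> U'" f] f0 by simp
  also have "\<dots> \<le> (16 * exp 1 * l + 5488 / 3 * l\<^sup>2) * B + (B + B)"
    using R_bound unbalanced unbalanced' by (intro add_mono) (auto simp: U_def U'_def f_def)
  finally show ?thesis by (simp add: algebra_simps)
qed

section \<open>Nets and the spectral norm\<close>

text \<open>Volume packing: the balls of radius 1 / 8 around the points are disjoint and lie in the
  ball of radius 9 / 8 around 0.\<close>

lemma separated_sphere_card_le:
  fixes S :: "'a::euclidean_space set"
  assumes fin: "finite S" and sub: "S \<subseteq> sphere 0 1"
    and sep: "\<And>x y. x \<in> S \<Longrightarrow> y \<in> S \<Longrightarrow> x \<noteq> y \<Longrightarrow> dist x y > 1 / 4"
  shows "real (card S) \<le> 9 ^ DIM('a)"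
proof -
  let ?V = "unit_ball_vol (real DIM('a))"
  have disj: "disjoint_family_on (\<lambda>x. ball x (1 / 8)) S"
    unfolding disjoint_family_on_def
  proof (intro ballI impI)
    fix x y assume "x \<in> S" "y \<in> S" "x \<noteq> y"
    then have "dist x y > 1 / 4" by (rule sep)
    then show "ball x (1 / 8) \<inter> ball y (1 / 8) = {}" by (intro disjoint_ballI) auto
  qed
  have "real (card S) * (?V * (1 / 8) ^ DIM('a)) = (\<Sum>x\<in>S. measure lborel (ball x (1 / 8 :: real)))"
    by (simp add: content_ball)
  also have "\<dots> = measure lborel (\<Union>x\<in>S. ball x (1 / 8))"
    using fin disj less_imp_neq[OF emeasure_lborel_ball_finite]
    by (intro measure_finite_Union[symmetric]) auto
  also have "\<dots> \<le> measure lborel (ball (0 :: 'a) (9 / 8))"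
  proof (rule measure_mono_fmeasurable)
    show "(\<Union>x\<in>S. ball x (1 / 8)) \<subseteq> ball 0 (9 / 8)"
    proof
      fix z assume "z \<in> (\<Union>x\<in>S. ball x (1 / 8))"
      then obtain x where x: "x \<in> S" "dist x z < 1 / 8" by auto
      then have "norm x = 1" using sub by auto
      then show "z \<in> ball 0 (9 / 8)" using x norm_triangle_sub[of z x]
        by (simp add: dist_norm norm_minus_commute)
    qed
  next
    show "ball (0 :: 'a) (9 / 8) \<in> fmeasurable lborel"
      using emeasure_lborel_ball_finite[of "0 :: 'a" "9/8"] by (simp add: fmeasurable_def)
    show "(\<Union>x\<in>S. ball x (1 / 8)) \<in> sets lborel"
      by (simp add: open_UN borel_open)
  qed
  also have "\<dots> = ?V * (9 / 8) ^ DIM('a)" by (simp add: content_ball)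
  finally have "real (card S) * (1 / 8) ^ DIM('a) \<le> (9 / 8) ^ DIM('a)"
    using unit_ball_vol_pos[of "real DIM('a)"] by (simp add: mult.left_commute)
  then have "real (card S) \<le> 9 ^ DIM('a)"
    by (simp only: power_divide power_one times_divide_eq_right mult_1_right divide_le_cancel) simp
  then show ?thesis .
qed

text \<open>A separated set of largest cardinality is a net, since a point far from all its members
  could be added; the packing bound ensures that such a set exists.\<close>

lemma exists_sphere_net:
  obtains S :: "'a::euclidean_space set"
  where "finite S" "S \<subseteq> sphere 0 1" "real (card S) \<le> 9 ^ DIM('a)"
    "\<forall>x. norm x = 1 \<longrightarrow> (\<exists>y\<in>S. dist x y \<le> 1 / 4)"
proof -
  define P where "P = (\<lambda>S :: 'a set. finite S \<and> S \<subseteq> sphere 0 1 \<and>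
    (\<forall>x\<in>S. \<forall>y\<in>S. x \<noteq> y \<longrightarrow> dist x y > 1 / 4))"
  have bound: "card S \<le> 9 ^ DIM('a)" if "P S" for S
    using separated_sphere_card_le[of S] that unfolding P_def
    by (metis of_nat_le_iff of_nat_numeral of_nat_power)
  have "P {}" by (simp add: P_def)
  then obtain S where S: "P S" and max: "\<And>T. P T \<Longrightarrow> card T \<le> card S"
    using ex_has_greatest_nat[of P "{}" card] bound by (metis less_Suc_eq_le)
  have "\<exists>y\<in>S. dist x y \<le> 1 / 4" if x: "norm x = 1" for x
  proof (rule ccontr)
    assume "\<not> ?thesis"
    then have far: "\<And>y. y \<in> S \<Longrightarrow> dist x y > 1 / 4" by force
    then have "x \<notin> S" by force
    moreover have "P (insert x S)"
      using S x far unfolding P_def by (auto simp: dist_commute)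
    ultimately show False using max[of "insert x S"] S by (simp add: P_def)
  qed
  then show thesis using that[of S] S bound[of S] unfolding P_def
    by (metis of_nat_le_iff of_nat_numeral of_nat_power)
qed

lemma quadratic_form_eq_sum:
  fixes W :: "real^'n^'n"
  shows "x \<bullet> (W *v x) = (\<Sum>i\<in>UNIV. \<Sum>j\<in>UNIV. W $ i $ j * x $ i * x $ j)"
  by (simp add: inner_vec_def matrix_vector_mult_def sum_distrib_left mult_ac)

text \<open>For symmetric matrices the polarization identity shows that the norm is the supremum of the
  quadratic form on the sphere; passing to the net loses half of that supremum.\<close>

lemma onorm_symmetric_le_net:
  fixes W :: "real^'n^'n"
  assumes sym: "\<And>i j. W $ i $ j = W $ j $ i"
    and net: "\<And>x :: real^'n. norm x = 1 \<Longrightarrow> \<exists>y\<in>S. dist x y \<le> 1 / 4"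
    and S: "S \<subseteq> sphere 0 1"
    and le: "\<And>y. y \<in> S \<Longrightarrow> \<bar>y \<bullet> (W *v y)\<bar> \<le> r"
  shows "onorm (\<lambda>x. W *v x) \<le> 2 * r"
proof -
  let ?s = "onorm (\<lambda>x. W *v x)"
  have bl: "bounded_linear (\<lambda>x. W *v x)" by (rule matrix_vector_mul_bounded_linear)
  have s0: "?s \<ge> 0" by (rule onorm_pos_le[OF bl])
  have swap: "x \<bullet> (W *v y) = y \<bullet> (W *v x)" for x y
  proof -
    have "transpose W = W" using sym by (simp add: transpose_def vec_eq_iff)
    then show ?thesis by (metis dot_lmul_matrix inner_commute vector_transpose_matrix)
  qed
  have bil: "\<bar>x \<bullet> (W *v y)\<bar> \<le> norm x * norm y * ?s" for x y
    using Cauchy_Schwarz_ineq2[of x "W *v y"] onorm[OF bl, of y]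
      mult_left_mono[OF onorm[OF bl, of y] norm_ge_zero[of x]] by (simp add: mult_ac)
  \<comment> \<open>One argument of the bilinear form at a time is moved to the net point; each move
    costs at most a quarter of the norm.\<close>
  have unit: "\<bar>x \<bullet> (W *v x)\<bar> \<le> r + ?s / 2" if x: "norm x = 1" for x
  proof -
    obtain y where y: "y \<in> S" "dist x y \<le> 1 / 4" using net[OF x] by auto
    have ny: "norm y = 1" using y S by auto
    have "x \<bullet> (W *v x) = y \<bullet> (W *v y) + ((x - y) \<bullet> (W *v x) + y \<bullet> (W *v (x - y)))"
      by (simp add: inner_diff_left inner_diff_right matrix_vector_mult_diff_distrib)
    moreover have "\<bar>(x - y) \<bullet> (W *v x)\<bar> \<le> 1 / 4 * ?s"
      using bil[of "x - y" x] x y s0 mult_right_mono[of "norm (x - y)" "1/4" ?s]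
      by (simp add: dist_norm)
    moreover have "\<bar>y \<bullet> (W *v (x - y))\<bar> \<le> 1 / 4 * ?s"
      using bil[of y "x - y"] ny y s0 mult_right_mono[of "norm (x - y)" "1/4" ?s]
      by (simp add: dist_norm)
    ultimately show ?thesis using le[OF y(1)] by linarith
  qed
  have quad: "\<bar>x \<bullet> (W *v x)\<bar> \<le> (r + ?s / 2) * (norm x)\<^sup>2" for x
  proof (cases "x = 0")
    case False
    define u where "u = (1 / norm x) *\<^sub>R x"
    have u: "norm u = 1" "x = norm x *\<^sub>R u" using False by (auto simp: u_def)
    have "x \<bullet> (W *v x) = (norm x)\<^sup>2 * (u \<bullet> (W *v u))"
      by (subst (1 2) u(2)) (simp add: matrix_vector_mult_scaleR power2_eq_square)
    then show ?thesis
      using mult_left_mono[OF unit[OF u(1)], of "(norm x)\<^sup>2"] by (simp add: abs_mult mult.commute)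
  qed simp
  have "norm (W *v x) \<le> (r + ?s / 2) * norm x" for x
  proof (cases "x = 0 \<or> W *v x = 0")
    case True
    have "r + ?s / 2 \<ge> 0" if "x \<noteq> 0"
      using order_trans[OF abs_ge_zero unit[of "(1 / norm x) *\<^sub>R x"]] that by simp
    with True show ?thesis by (cases "x = 0") auto
  next
    case False
    define u v where "u = (1 / norm x) *\<^sub>R x" and "v = (1 / norm (W *v x)) *\<^sub>R (W *v x)"
    have n: "norm u = 1" "norm v = 1" using False by (auto simp: u_def v_def)
    \<comment> \<open>Polarization is applied to the unit vectors in the directions of
      \<open>x\<close> and of its image; by the parallelogram law the two squared norms add up to
      4.\<close>
    have "4 * (v \<bullet> (W *v u)) = (v + u) \<bullet> (W *v (v + u)) - (v - u) \<bullet> (W *v (v - u))"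
      using swap[of u v]
      by (simp add: inner_diff_left inner_diff_right inner_add_left inner_add_right
          matrix_vector_mult_diff_distrib matrix_vector_right_distrib)
    also have "\<dots> \<le> (r + ?s / 2) * (norm (v + u))\<^sup>2 + (r + ?s / 2) * (norm (v - u))\<^sup>2"
      using quad[of "v + u"] quad[of "v - u"] by linarith
    also have "\<dots> = (r + ?s / 2) * ((norm (v + u))\<^sup>2 + (norm (v - u))\<^sup>2)"
      by (simp add: distrib_left)
    also have "(norm (v + u))\<^sup>2 + (norm (v - u))\<^sup>2 = 2 * (norm v)\<^sup>2 + 2 * (norm u)\<^sup>2"
      by (simp add: power2_norm_eq_inner inner_diff_left inner_diff_right inner_add_left
          inner_add_right inner_commute)
    finally have "v \<bullet> (W *v u) \<le> r + ?s / 2" using n by simp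
    moreover have "v \<bullet> (W *v u) = norm (W *v x) / norm x"
      using False by (simp add: u_def v_def matrix_vector_mult_scaleR
          power2_norm_eq_inner[symmetric] power2_eq_square)
    ultimately show ?thesis using False by (simp add: field_simps)
  qed
  \<comment> \<open>The norm is on both sides; absorbing half of it on the left leaves the factor
    2.\<close>
  then have "?s \<le> r + ?s / 2" by (rule onorm_le)
  then show ?thesis by simp
qed

section \<open>Sums of independent events\<close>

lemma exp_le_quadratic:
  fixes u :: real
  assumes "\<bar>u\<bar> \<le> 1"
  shows "exp u \<le> 1 + u + u\<^sup>2"
proof (cases "u \<ge> 0")
  case True
  then show ?thesis using assms by (intro exp_bound) auto
next
  case False
  define v where "v = - u"
  have v: "v > 0" using False by (simp add: v_def)
  have "exp (- v) \<le> 1 / (1 + v)"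
    using exp_ge_add_one_self[of v] v by (simp add: exp_minus inverse_eq_divide frac_le)
  also have "\<dots> \<le> 1 - v + v\<^sup>2"
  proof -
    have "(1 - v + v\<^sup>2) * (1 + v) = 1 + v ^ 3"
      by (simp add: power2_eq_square power3_eq_cube algebra_simps)
    also have "\<dots> \<ge> 1" using v by simp
    finally show ?thesis using v by (simp add: pos_divide_le_eq)
  qed
  finally show ?thesis by (simp add: v_def)
qed

context prob_space
begin

text \<open>Expanding the product over the subsets of \<open>I\<close> gives a linear combination of
  indicators of intersections. Independence factors their probabilities, and the expansion is folded
  back.\<close>

lemma expectation_prod_indep_events:
  fixes d :: "'i \<Rightarrow> real"
  assumes fin: "finite I" and indep: "indep_events E I"
  shows "expectation (\<lambda>\<omega>. \<Prod>h\<in>I. d h * indicat_real (E h) \<omega> + 1) = (\<Prod>h\<in>I. d h * prob (E h) + 1)"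
proof -
  have ev: "E h \<in> events" if "h \<in> I" for h using indep that by (auto simp: indep_events_def)
  \<comment> \<open>Intersecting with \<open>space M\<close> lets the empty subset contribute the
    whole space rather than \<open>UNIV\<close>.\<close>
  have prod_eq: "(\<Prod>h\<in>J. d h * indicat_real (E h) \<omega>) = prod d J * indicator (space M \<inter> (\<Inter>h\<in>J. E h)) \<omega>"
    if "finite J" "\<omega> \<in> space M" for J \<omega>
    using that by (induction J rule: finite_induct) (auto simp: indicator_def)
  have sets: "space M \<inter> (\<Inter>h\<in>J. E h) \<in> events" if "J \<in> Pow I" for J
  proof (cases "J = {}")
    case False
    then have "(\<Inter>h\<in>J. E h) \<in> events"
      using that fin ev by (intro sets.finite_INT) (auto intro: finite_subset)
    then show ?thesis by auto
  qed simp
  have pr: "prob (space M \<inter> (\<Inter>h\<in>J. E h)) = (\<Prod>h\<in>J. prob (E h))" if J: "J \<in> Pow I" for J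
  proof (cases "J = {}")
    case False
    have fJ: "finite J" using J fin by (auto intro: finite_subset)
    have "space M \<inter> (\<Inter>h\<in>J. E h) = (\<Inter>h\<in>J. E h)"
      using False J ev sets.sets_into_space by (intro Int_absorb1) blast
    then show ?thesis using indep False J fJ by (auto simp: indep_events_def)
  qed (simp add: prob_space)
  have "expectation (\<lambda>\<omega>. \<Prod>h\<in>I. d h * indicat_real (E h) \<omega> + 1)
      = expectation (\<lambda>\<omega>. \<Sum>J\<in>Pow I. prod d J * indicator (space M \<inter> (\<Inter>h\<in>J. E h)) \<omega>)"
    using fin by (intro Bochner_Integration.integral_cong refl)
      (simp add: prod_add prod_eq finite_subset)
  also have "\<dots> = (\<Sum>J\<in>Pow I. expectation (\<lambda>\<omega>. prod d J * indicator (space M \<inter> (\<Inter>h\<in>J. E h)) \<omega>))"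
    using sets by (intro Bochner_Integration.integral_sum integrable_mult_right)
      (simp add: less_top[symmetric])
  also have "\<dots> = (\<Sum>J\<in>Pow I. \<Prod>h\<in>J. d h * prob (E h))"
    using sets by (intro sum.cong refl) (simp add: pr prod.distrib)
  also have "\<dots> = (\<Prod>h\<in>I. d h * prob (E h) + 1)"
    using fin by (simp add: prod_add)
  finally show ?thesis .
qed

text \<open>Each indicator contributes 1 + p (exp c - 1), which is at most the moment generating
  function of a Poisson variable of mean p.\<close>

lemma mgf_indep_events_le:
  fixes c :: "'i \<Rightarrow> real"
  assumes fin: "finite I" and indep: "indep_events E I"
  shows "expectation (\<lambda>\<omega>. exp (\<Sum>h\<in>I. c h * indicat_real (E h) \<omega>))
           \<le> exp (\<Sum>h\<in>I. prob (E h) * (exp (c h) - 1))"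
proof -
  have "exp (\<Sum>h\<in>I. c h * indicat_real (E h) \<omega>) = (\<Prod>h\<in>I. (exp (c h) - 1) * indicat_real (E h) \<omega> + 1)" for \<omega>
    unfolding exp_sum[OF fin] by (intro prod.cong) (auto simp: indicator_def)
  then have "expectation (\<lambda>\<omega>. exp (\<Sum>h\<in>I. c h * indicat_real (E h) \<omega>))
      = (\<Prod>h\<in>I. (exp (c h) - 1) * prob (E h) + 1)"
    using expectation_prod_indep_events[OF fin indep] by simp
  also have "\<dots> \<le> (\<Prod>h\<in>I. exp (prob (E h) * (exp (c h) - 1)))"
  proof (intro prod_mono conjI)
    fix h
    have "0 \<le> (1 - prob (E h)) + exp (c h) * prob (E h)" by simp
    then show "0 \<le> (exp (c h) - 1) * prob (E h) + 1" by (simp add: algebra_simps)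
    show "(exp (c h) - 1) * prob (E h) + 1 \<le> exp (prob (E h) * (exp (c h) - 1))"
      using exp_ge_add_one_self[of "prob (E h) * (exp (c h) - 1)"] by (simp add: mult.commute add.commute)
  qed
  also have "\<dots> = exp (\<Sum>h\<in>I. prob (E h) * (exp (c h) - 1))" by (simp add: exp_sum[OF fin])
  finally show ?thesis .
qed

lemma borel_measurable_sum_indep_events:
  fixes c :: "'i \<Rightarrow> real"
  assumes "indep_events E I"
  shows "(\<lambda>\<omega>. \<Sum>h\<in>I. c h * indicat_real (E h) \<omega>) \<in> borel_measurable M"
  using assms by (intro borel_measurable_sum borel_measurable_times borel_measurable_indicator)
    (auto simp: indep_events_def)

text \<open>Markov's inequality for the exponential of the sum. The Chernoff exponent is absorbed
  into the coefficients \<open>c\<close>, which may have either sign.\<close>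

lemma indep_events_tail_le:
  fixes c :: "'i \<Rightarrow> real"
  assumes fin: "finite I" and indep: "indep_events E I"
  shows "prob {\<omega> \<in> space M. (\<Sum>h\<in>I. c h * indicat_real (E h) \<omega>) \<ge> t}
           \<le> exp ((\<Sum>h\<in>I. prob (E h) * (exp (c h) - 1)) - t)"
proof -
  let ?Z = "\<lambda>\<omega>. \<Sum>h\<in>I. c h * indicat_real (E h) \<omega>"
  note [measurable] = borel_measurable_sum_indep_events[OF indep, of c]
  have "?Z \<omega> \<le> (\<Sum>h\<in>I. \<bar>c h\<bar>)" for \<omega>
    by (intro sum_mono) (auto simp: indicator_def)
  then have int: "integrable M (\<lambda>\<omega>. exp (?Z \<omega>))"
    by (intro integrable_const_bound[of _ "exp (\<Sum>h\<in>I. \<bar>c h\<bar>)"]) auto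
  have "prob {\<omega> \<in> space M. ?Z \<omega> \<ge> t} = prob {\<omega> \<in> space M. exp (?Z \<omega>) \<ge> exp t}" by simp
  also have "\<dots> \<le> expectation (\<lambda>\<omega>. exp (?Z \<omega>)) / exp t"
    using int by (intro integral_Markov_inequality_measure[where A = "{}"]) auto
  also have "\<dots> \<le> exp (\<Sum>h\<in>I. prob (E h) * (exp (c h) - 1)) / exp t"
    using mgf_indep_events_le[OF fin indep] by (intro divide_right_mono) auto
  finally show ?thesis by (simp add: exp_diff)
qed

text \<open>In the bound exp u \<le> 1 + u + u^2, applied to u = \<open>r * y h\<close>, centring
  cancels the linear terms and only \<open>r\<^sup>2 * v\<close> remains.\<close>

lemma indep_events_centered_tail_le:
  fixes y :: "'i \<Rightarrow> real"
  assumes fin: "finite I" and indep: "indep_events E I"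
    and r: "r > 0" and bound: "\<And>h. h \<in> I \<Longrightarrow> \<bar>r * y h\<bar> \<le> 1"
    and var: "(\<Sum>h\<in>I. prob (E h) * (y h)\<^sup>2) \<le> v"
  shows "prob {\<omega> \<in> space M. (\<Sum>h\<in>I. y h * (indicat_real (E h) \<omega> - prob (E h))) \<ge> t}
           \<le> exp (r\<^sup>2 * v - r * t)"
proof -
  define \<mu> where "\<mu> = (\<Sum>h\<in>I. r * (y h * prob (E h)))"
  have eq: "(\<Sum>h\<in>I. y h * (indicat_real (E h) \<omega> - prob (E h))) \<ge> t
      \<longleftrightarrow> (\<Sum>h\<in>I. (r * y h) * indicat_real (E h) \<omega>) \<ge> r * t + \<mu>" for \<omega>
  proof -
    have "(\<Sum>h\<in>I. (r * y h) * indicat_real (E h) \<omega>) - \<mu>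
        = r * (\<Sum>h\<in>I. y h * (indicat_real (E h) \<omega> - prob (E h)))"
      unfolding \<mu>_def sum_distrib_left sum_subtractf[symmetric]
      by (intro sum.cong refl) (simp add: algebra_simps)
    moreover have "r * t \<le> r * z \<longleftrightarrow> t \<le> z" for z using r by simp
    ultimately show ?thesis by (simp only: le_diff_eq[symmetric])
  qed
  have "prob {\<omega> \<in> space M. (\<Sum>h\<in>I. y h * (indicat_real (E h) \<omega> - prob (E h))) \<ge> t}
      \<le> exp ((\<Sum>h\<in>I. prob (E h) * (exp (r * y h) - 1)) - (r * t + \<mu>))"
    unfolding eq by (rule indep_events_tail_le[OF fin indep])
  also have "\<dots> \<le> exp (r\<^sup>2 * v - r * t)"
  proof -
    have "(\<Sum>h\<in>I. prob (E h) * (exp (r * y h) - 1)) \<le> (\<Sum>h\<in>I. prob (E h) * (r * y h + (r * y h)\<^sup>2))"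
    proof (intro sum_mono mult_left_mono)
      fix h assume "h \<in> I"
      then show "exp (r * y h) - 1 \<le> r * y h + (r * y h)\<^sup>2"
        using exp_le_quadratic[OF bound, of h] by linarith
    qed (rule measure_nonneg)
    also have "\<dots> = \<mu> + r\<^sup>2 * (\<Sum>h\<in>I. prob (E h) * (y h)\<^sup>2)"
      unfolding \<mu>_def sum_distrib_left sum.distrib[symmetric]
      by (intro sum.cong refl) (simp add: algebra_simps power_mult_distrib)
    also have "\<dots> \<le> \<mu> + r\<^sup>2 * v"
      by (intro add_left_mono mult_left_mono var) simp
    finally show ?thesis unfolding exp_le_cancel_iff by linarith
  qed
  finally show ?thesis .
qed

text \<open>Chernoff bounds for all exponents \<open>r\<close> at once at the price of a single one: because the
  sum is integer valued, the exceptional event is \<open>{Z \<ge> n}\<close> for the least bad value \<open>n\<close>.\<close>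

lemma indep_events_uniform_chernoff:
  fixes w :: "'i \<Rightarrow> nat" and \<Lambda> :: "real \<Rightarrow> real"
  assumes fin: "finite I" and indep: "indep_events E I"
    and \<Lambda>: "\<And>r :: real. r > 0 \<Longrightarrow> (\<Sum>h\<in>I. prob (E h) * (exp (r * w h) - 1)) \<le> \<Lambda> r"
  shows "\<exists>B\<in>events. prob B \<le> exp (- K) \<and>
    (\<forall>\<omega>\<in>space M - B. \<forall>r::real. r > 0 \<longrightarrow> r * (\<Sum>h\<in>I. w h * indicat_real (E h) \<omega>) \<le> \<Lambda> r + K)"
proof -
  define bad where "bad = (\<lambda>n :: nat. \<exists>r::real. r > 0 \<and> r * n > \<Lambda> r + K)"
  define Z where "Z = (\<lambda>\<omega>. \<Sum>h\<in>I. w h * (indicator (E h) \<omega> :: nat))"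
  have Z_eq: "real (Z \<omega>) = (\<Sum>h\<in>I. w h * indicat_real (E h) \<omega>)" for \<omega>
    unfolding Z_def by (simp add: of_nat_sum) (auto intro!: sum.cong simp: indicator_def)
  have good: "r * (\<Sum>h\<in>I. w h * indicat_real (E h) \<omega>) \<le> \<Lambda> r + K"
    if "\<not> bad (Z \<omega>)" "r > 0" for \<omega> r
    using that unfolding bad_def Z_eq by force
  show ?thesis
  proof (cases "\<exists>n. bad n")
    case False
    then show ?thesis using good by (intro bexI[of _ "{}"]) simp_all
  next
    case True
    define n where "n = (LEAST n. bad n)"
    have "bad n" unfolding n_def using True by (rule LeastI_ex)
    then obtain r :: real where r: "r > 0" "r * n > \<Lambda> r + K" by (auto simp: bad_def)
    define B where "B = {\<omega> \<in> space M. (\<Sum>h\<in>I. (r * w h) * indicat_real (E h) \<omega>) \<ge> r * n}"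
    have "prob B \<le> exp ((\<Sum>h\<in>I. prob (E h) * (exp (r * w h) - 1)) - r * n)"
      unfolding B_def by (rule indep_events_tail_le[OF fin indep])
    also have "\<dots> \<le> exp (- K)" using \<Lambda>[OF r(1)] r(2) by simp
    finally have 1: "prob B \<le> exp (- K)" .
    have 2: "B \<in> events"
      using borel_measurable_sum_indep_events[OF indep, of "\<lambda>h. r * w h"] unfolding B_def by measurable
    have "\<not> bad (Z \<omega>)" if "\<omega> \<in> space M - B" for \<omega>
    proof
      assume "bad (Z \<omega>)"
      then have "n \<le> Z \<omega>" unfolding n_def by (rule Least_le)
      then have "r * n \<le> r * real (Z \<omega>)" using r(1) by simp
      also have "\<dots> = (\<Sum>h\<in>I. (r * w h) * indicat_real (E h) \<omega>)"
        unfolding Z_eq by (simp add: sum_distrib_left mult.assoc)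
      finally show False using that by (simp add: B_def)
    qed
    then show ?thesis using 1 good by (intro bexI[OF _ 2]) simp
  qed
qed

end

text \<open>Convexity of exp between 0 and \<open>r * m\<close>. A weight below \<open>m\<close> is
  charged as the fraction \<open>w / m\<close> of an extreme one, so only the expected weight enters
  the Chernoff bound.\<close>

lemma exp_convex_chord:
  fixes r w m :: real
  assumes "0 \<le> w" "w \<le> m" "m > 0"
  shows "exp (r * w) - 1 \<le> w / m * (exp (r * m) - 1)"
proof -
  have "exp ((1 - w / m) *\<^sub>R 0 + (w / m) *\<^sub>R (r * m)) \<le> (1 - w / m) * exp 0 + (w / m) * exp (r * m)"
    using assms by (intro convex_onD[OF exp_convex]) (auto simp: field_simps)
  moreover have "(w / m) *\<^sub>R (r * m) = r * w" using assms by simp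
  ultimately show ?thesis by (simp add: algebra_simps)
qed

lemma card_supersets_of_size:
  fixes F :: "'n::finite set"
  assumes "card F \<le> l"
  shows "card {e. card e = l \<and> F \<subseteq> e} = (CARD('n) - card F) choose (l - card F)"
proof -
  have "bij_betw (\<lambda>e. e - F) {e. card e = l \<and> F \<subseteq> e} {B. B \<subseteq> - F \<and> card B = l - card F}"
  proof (rule bij_betwI[where g = "\<lambda>B. B \<union> F"])
    show "(\<lambda>B. B \<union> F) \<in> {B. B \<subseteq> - F \<and> card B = l - card F} \<rightarrow> {e. card e = l \<and> F \<subseteq> e}"
    proof clarsimp
      fix B assume B: "B \<subseteq> - F" "card B = l - card F"
      then have "card (B \<union> F) = card B + card F" by (intro card_Un_disjoint) auto
      then show "card (B \<union> F) = l" using B assms by simp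
    qed
  qed (auto simp: card_Diff_subset)
  then have "card {e. card e = l \<and> F \<subseteq> e} = card {B. B \<subseteq> - F \<and> card B = l - card F}"
    by (rule bij_betw_same_card)
  also have "\<dots> = card (- F) choose (l - card F)" by (rule n_subsets) simp
  also have "card (- F) = CARD('n) - card F" by (simp add: Compl_eq_Diff_UNIV card_Diff_subset)
  finally show ?thesis .
qed

text \<open>The single term s^s / s! of the exponential series of s already gives s! \<ge> (s /
  e)^s.\<close>

lemma binomial_le_exp_set_cost:
  assumes "1 \<le> s" "s \<le> n"
  shows "real (n choose s) \<le> exp (set_cost n s)"
proof -
  have "real s ^ s / fact s \<le> exp (real s)"
  proof -
    have "(\<Sum>k\<in>{s}. real s ^ k /\<^sub>R fact k) \<le> (\<Sum>k. real s ^ k /\<^sub>R fact k)"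
      using summable_exp_generic[of "real s"] by (intro sum_le_suminf) auto
    then show ?thesis by (simp add: exp_def divide_inverse mult.commute)
  qed
  moreover have "exp (real s) = exp 1 ^ s" using exp_of_nat_mult[of s "1 :: real"] by simp
  ultimately have f: "(real s / exp 1) ^ s \<le> fact s"
    by (simp add: power_divide pos_divide_le_eq mult.commute)
  have "real (n choose s) * (real s / exp 1) ^ s \<le> real (n choose s) * fact s"
    using f by (intro mult_left_mono) auto
  also have "\<dots> \<le> real n ^ s"
    using binomial_fact_pow[of n s] by (metis of_nat_fact of_nat_le_iff of_nat_mult of_nat_power)
  finally have "real (n choose s) \<le> real n ^ s / (real s / exp 1) ^ s"
    using assms by (subst pos_le_divide_eq) auto
  also have "\<dots> = (exp 1 * (real n / real s)) ^ s"
    using assms by (simp add: power_divide power_mult_distrib)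
  also have "exp 1 * (real n / real s) = exp (1 + ln (real n / real s))"
    using assms by (subst exp_add) simp
  also have "\<dots> ^ s = exp (real s * (1 + ln (real n / real s)))"
    by (rule exp_of_nat_mult[symmetric])
  finally show ?thesis by (simp only: set_cost_def)
qed

section \<open>The random hypergraph\<close>

text \<open>The union bound is phrased with exceptional events, so that the outcomes satisfying
  \<open>P x\<close> need not form a measurable set.\<close>

lemma (in prob_space) finite_union_exceptional_event:
  assumes fin: "finite X"
    and ex: "\<And>x. x \<in> X \<Longrightarrow> \<exists>B\<in>events. prob B \<le> f x \<and> (\<forall>\<omega>\<in>space M - B. P x \<omega>)"
  shows "\<exists>B\<in>events. prob B \<le> sum f X \<and> (\<forall>\<omega>\<in>space M - B. \<forall>x\<in>X. P x \<omega>)"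
proof -
  obtain B where B: "\<And>x. x \<in> X \<Longrightarrow> B x \<in> events" "\<And>x. x \<in> X \<Longrightarrow> prob (B x) \<le> f x"
    "\<And>x \<omega>. x \<in> X \<Longrightarrow> \<omega> \<in> space M - B x \<Longrightarrow> P x \<omega>"
    using ex by metis
  have "prob (\<Union>x\<in>X. B x) \<le> (\<Sum>x\<in>X. prob (B x))"
    using fin B(1) by (intro finite_measure_subadditive_finite) auto
  also have "\<dots> \<le> sum f X" by (intro sum_mono B(2))
  finally have "prob (\<Union>x\<in>X. B x) \<le> sum f X" .
  moreover have "(\<Union>x\<in>X. B x) \<in> events" using fin B(1) by auto
  ultimately show ?thesis using B(3) by (intro bexI[of _ "\<Union>x\<in>X. B x"]) auto
qed

text \<open>As a function of \<open>s\<close> the cost has derivative ln (n / s), so it increases on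
  [1, n]; the bound is its value at s = 1.\<close>

lemma set_cost_ge:
  assumes "1 \<le> s" "s \<le> n"
  shows "set_cost n s \<ge> 1 + ln n"
proof -
  have "ln s \<le> s - 1" using assms by (intro ln_le_minus_one) auto
  moreover have "(s - 1) * ln s \<le> (s - 1) * ln n" using assms by (intro mult_left_mono) auto
  ultimately show ?thesis using assms by (simp add: set_cost_def ln_div algebra_simps)
qed

text \<open>One of the seven copies of the cost pays for the number of sets of a given size; the
  other six leave at most N^(-6) for each of the N sizes. Applied to both sets of a pair this yields
  N^(-10).\<close>

lemma sum_exp_set_cost_le:
  defines "N \<equiv> real CARD('n::finite)"
  shows "(\<Sum>S | S \<noteq> ({} :: 'n set). exp (- 7 * set_cost N (card S))) \<le> 1 / N ^ 5"
proof -
  have Npos: "N > 0" by (simp add: N_def)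
  have "(\<Sum>S | S \<noteq> ({} :: 'n set). exp (- 7 * set_cost N (card S)))
      = (\<Sum>s\<in>{1..CARD('n)}. \<Sum>S | S \<in> {S. S \<noteq> ({} :: 'n set)} \<and> card S = s. exp (- 7 * set_cost N (card S)))"
    by (rule sum.group[symmetric]) (auto simp: Suc_le_eq card_gt_0_iff card_mono)
  also have "\<dots> \<le> (\<Sum>s\<in>{1..CARD('n)}. 1 / N ^ 6)"
  proof (rule sum_mono)
    fix s assume s: "s \<in> {1..CARD('n)}"
    have "{S. S \<in> {S. S \<noteq> ({} :: 'n set)} \<and> card S = s} = {S. S \<subseteq> UNIV \<and> card S = s}"
      using s by auto
    then have c: "card {S. S \<in> {S. S \<noteq> ({} :: 'n set)} \<and> card S = s} = CARD('n) choose s"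
      using n_subsets[of "UNIV :: 'n set" s] by simp
    have "(\<Sum>S | S \<in> {S. S \<noteq> ({} :: 'n set)} \<and> card S = s. exp (- 7 * set_cost N (card S)))
        = (\<Sum>S | S \<in> {S. S \<noteq> ({} :: 'n set)} \<and> card S = s. exp (- 7 * set_cost N s))"
      by (rule sum.cong) auto
    also have "\<dots> = real (CARD('n) choose s) * exp (- 7 * set_cost N s)"
      unfolding sum_constant c ..
    also have "\<dots> \<le> exp (set_cost N s) * exp (- 7 * set_cost N s)"
      using binomial_le_exp_set_cost[of s "CARD('n)"] s
      by (intro mult_right_mono) (auto simp: N_def)
    also have "\<dots> = exp (- 6 * set_cost N s)" by (simp flip: exp_add)
    also have "\<dots> \<le> exp (- (6 * ln N))"
      using set_cost_ge[of "real s" N] s by (simp add: N_def)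
    also have "\<dots> = 1 / N ^ 6"
      using Npos exp_of_nat_mult[of 6 "ln N"] by (simp add: exp_minus inverse_eq_divide)
    finally show "(\<Sum>S | S \<in> {S. S \<noteq> ({} :: 'n set)} \<and> card S = s. exp (- 7 * set_cost N (card S))) \<le> 1 / N ^ 6" .
  qed
  also have "\<dots> = 1 / N ^ 5"
    using Npos by (simp add: N_def[symmetric] power_eq_if)
  finally show ?thesis .
qed

text \<open>With a = n - 2 and b = l - 2, the absorption identity matches (a + 1) (a choose b) with
  (b + 1) (a + 1 choose b + 1), and Pascal's rule handles the remaining copy. It bounds codegrees by
  l / n times degrees.\<close>

lemma mult_binomial_pair_le:
  assumes "n \<ge> 2" "l \<ge> 2"
  shows "n * ((n - 2) choose (l - 2)) \<le> l * ((n - 1) choose (l - 1))"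
proof -
  obtain a where a: "n = Suc (Suc a)" using assms(1) by (metis add_2_eq_Suc le_Suc_ex)
  obtain b where b: "l = Suc (Suc b)" using assms(2) by (metis add_2_eq_Suc le_Suc_ex)
  have "Suc b * (Suc a choose Suc b) = Suc a * (a choose b)" using Suc_times_binomial_eq[of a b] by (simp only: mult.commute)
  then show ?thesis by (simp add: a b)
qed

definition ordered_pairs :: "'n set \<Rightarrow> ('n \<times> 'n) set" where
  "ordered_pairs e = {(i, j). i \<noteq> j \<and> i \<in> e \<and> j \<in> e}"

lemma card_ordered_pairs_le:
  fixes e :: "'n::finite set"
  shows "card (ordered_pairs e) \<le> (card e)\<^sup>2"
proof -
  have "card (ordered_pairs e) \<le> card (e \<times> e)" by (intro card_mono) (auto simp: ordered_pairs_def)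
  then show ?thesis by (simp add: power2_eq_square card_cartesian_product)
qed

section \<open>Expected degrees, the adjacency matrix as a sum over hyperedges, and exceptional
  events\<close>

context inhomogeneous_ER_hypergraph
begin

abbreviation D :: real where "D \<equiv> total_max_degree L Q"
abbreviation Lmax :: real where "Lmax \<equiv> real (Max L)"

definition edge_index :: "(nat \<times> 'n set) set" where
  "edge_index = (SIGMA l:L. {e. card e = l})"

definition edge_event :: "nat \<times> 'n set \<Rightarrow> 'w set" where
  "edge_event = (\<lambda>(l, e). {\<omega> \<in> space M. e \<in> H l \<omega>})"

definition qmax :: "nat \<Rightarrow> real" where
  "qmax l = Max (Q l ` {xs. length xs = l})"

lemma finite_edge_index: "finite edge_index"
  unfolding edge_index_def using finite_L by (intro finite_SigmaI) auto

lemma indep_edges: "indep_events edge_event edge_index"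
  using H_indep by (simp add: edge_event_def edge_index_def)

lemma edge_event_sets [measurable]: "h \<in> edge_index \<Longrightarrow> edge_event h \<in> events"
  using indep_edges by (auto simp: indep_events_def)

lemma Lmax_ge: "Lmax \<ge> 2"
  using L_ge_2 Max_in[OF finite_L L_nonempty] by fastforce

lemma L_le_Lmax: "l \<in> L \<Longrightarrow> real l \<le> Lmax"
  using finite_L by simp

lemma Q_le_qmax: "length xs = l \<Longrightarrow> Q l xs \<le> qmax l"
proof -
  have "finite {xs :: 'n list. length xs = l}"
    using finite_lists_length_eq[of "UNIV :: 'n set" l] by simp
  then show "length xs = l \<Longrightarrow> Q l xs \<le> qmax l"
    unfolding qmax_def by (intro Max_ge) auto
qed

lemma qmax_nonneg: "l \<in> L \<Longrightarrow> qmax l \<ge> 0"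
  using Q_le_qmax[of "replicate l undefined" l] Q_range[of l "replicate l undefined"] by simp

lemma prob_edge_le:
  assumes "(l, e) \<in> edge_index"
  shows "prob (edge_event (l, e)) \<le> qmax l"
proof -
  have l: "l \<in> L" "card e = l" using assms by (auto simp: edge_index_def)
  obtain xs where xs: "set xs = e" "distinct xs" using finite_distinct_list[of e] by auto
  then have len: "length xs = l" using l distinct_card by fastforce
  show ?thesis
    using H_prob[OF l(1) len xs(2)] Q_le_qmax[OF len] by (simp add: edge_event_def xs(1))
qed

lemma D_eq: "D = (\<Sum>l\<in>L. real ((CARD('n) - 1) choose (l - 1)) * qmax l)"
  by (simp add: total_max_degree_def layer_max_degree_def qmax_def)

lemma D_nonneg: "D \<ge> 0"
  unfolding D_eq using qmax_nonneg by (intro sum_nonneg) auto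

text \<open>Singletons \<open>F\<close> give expected degrees, two-element \<open>F\<close> give the
  entries of EA. The bound on \<open>card F\<close> makes \<open>F\<close> fit into the hyperedges
  of every layer, all of which have size at least 2.\<close>

lemma sum_prob_supersets_le:
  assumes "card F \<le> 2"
  shows "(\<Sum>h\<in>edge_index. of_bool (F \<subseteq> snd h) * prob (edge_event h))
           \<le> (\<Sum>l\<in>L. real ((CARD('n) - card F) choose (l - card F)) * qmax l)"
proof -
  have "(\<Sum>h\<in>edge_index. of_bool (F \<subseteq> snd h) * prob (edge_event h))
      = (\<Sum>l\<in>L. \<Sum>e | card e = l. of_bool (F \<subseteq> e) * prob (edge_event (l, e)))"
    unfolding edge_index_def using finite_L by (subst sum.Sigma) (auto simp: case_prod_unfold)
  also have "\<dots> \<le> (\<Sum>l\<in>L. \<Sum>e | card e = l. of_bool (F \<subseteq> e) * qmax l)"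
    by (intro sum_mono mult_left_mono prob_edge_le) (auto simp: edge_index_def)
  also have "\<dots> = (\<Sum>l\<in>L. \<Sum>e | card e = l \<and> F \<subseteq> e. qmax l)"
  proof (rule sum.cong[OF refl])
    fix l
    show "(\<Sum>e | card e = l. of_bool (F \<subseteq> e) * qmax l) = (\<Sum>e | card e = l \<and> F \<subseteq> e. qmax l)"
      by (rule sum.mono_neutral_cong_right) auto
  qed
  also have "\<dots> = (\<Sum>l\<in>L. real ((CARD('n) - card F) choose (l - card F)) * qmax l)"
  proof (rule sum.cong[OF refl])
    fix l assume "l \<in> L"
    then have "card F \<le> l" using assms L_ge_2[of l] by simp
    then show "(\<Sum>e | card e = l \<and> F \<subseteq> e. qmax l) = real ((CARD('n) - card F) choose (l - card F)) * qmax l"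
      unfolding sum_constant by (simp only: card_supersets_of_size)
  qed
  finally show ?thesis .
qed

lemma expected_degree_le: "(\<Sum>h\<in>edge_index. of_bool (i \<in> snd h) * prob (edge_event h)) \<le> D"
  using sum_prob_supersets_le[of "{i}"] by (simp add: D_eq)

text \<open>\<open>mean_adj\<close> and \<open>adj\<close> are the entries of EA and A, written over
  one index set of independent hyperedges instead of layer by layer.\<close>

definition mean_adj :: "'n \<times> 'n \<Rightarrow> real" where
  "mean_adj z = (\<Sum>h\<in>edge_index. of_bool (z \<in> ordered_pairs (snd h)) * prob (edge_event h))"

definition adj :: "'w \<Rightarrow> 'n \<times> 'n \<Rightarrow> real" where
  "adj \<omega> z = (\<Sum>h\<in>edge_index. of_bool (z \<in> ordered_pairs (snd h)) * indicat_real (edge_event h) \<omega>)"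

lemma mean_adj_nonneg: "mean_adj z \<ge> 0"
  unfolding mean_adj_def by (intro sum_nonneg) auto

lemma adj_nonneg: "adj \<omega> z \<ge> 0"
  unfolding adj_def by (intro sum_nonneg) auto

lemma adj_sym: "adj \<omega> (i, j) = adj \<omega> (j, i)" and mean_adj_sym: "mean_adj (i, j) = mean_adj (j, i)"
  unfolding adj_def mean_adj_def ordered_pairs_def by (auto intro!: sum.cong)

lemma mean_adj_le: "mean_adj z \<le> Lmax * D / real CARD('n)"
proof (cases z)
  case (Pair i j)
  show ?thesis
  proof (cases "i = j")
    case True
    then show ?thesis
      using D_nonneg by (simp add: mean_adj_def ordered_pairs_def Pair)
  next
    case False
    have "card {i, j} \<le> CARD('n)" by (intro card_mono) auto
    then have N2: "CARD('n) \<ge> 2" using False by simp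
    have "mean_adj z \<le> (\<Sum>l\<in>L. real ((CARD('n) - 2) choose (l - 2)) * qmax l)"
      using sum_prob_supersets_le[of "{i, j}"] False
      by (simp add: mean_adj_def ordered_pairs_def Pair numeral_2_eq_2)
    also have "\<dots> \<le> (\<Sum>l\<in>L. Lmax / real CARD('n) * (real ((CARD('n) - 1) choose (l - 1)) * qmax l))"
    proof (rule sum_mono)
      fix l assume l: "l \<in> L"
      have "real CARD('n) * real ((CARD('n) - 2) choose (l - 2)) \<le> real l * real ((CARD('n) - 1) choose (l - 1))"
        using mult_binomial_pair_le[OF N2 L_ge_2[OF l]] by (metis of_nat_le_iff of_nat_mult)
      also have "\<dots> \<le> Lmax * real ((CARD('n) - 1) choose (l - 1))"
        using L_le_Lmax[OF l] by (intro mult_right_mono) auto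
      finally have "real ((CARD('n) - 2) choose (l - 2)) \<le> Lmax / real CARD('n) * real ((CARD('n) - 1) choose (l - 1))"
        by (simp add: pos_le_divide_eq mult.commute)
      then show "real ((CARD('n) - 2) choose (l - 2)) * qmax l
          \<le> Lmax / real CARD('n) * (real ((CARD('n) - 1) choose (l - 1)) * qmax l)"
        using mult_right_mono[OF _ qmax_nonneg[OF l]] by (fastforce simp only: mult.assoc)
    qed
    also have "\<dots> = Lmax * D / real CARD('n)" by (simp add: D_eq sum_distrib_left sum_divide_distrib)
    finally show ?thesis .
  qed
qed

lemma adjacency_matrix_eq_adj:
  assumes "\<omega> \<in> space M"
  shows "adjacency_matrix L H \<omega> $ i $ j = adj \<omega> (i, j)"
proof -
  have "adj \<omega> (i, j) = (\<Sum>l\<in>L. \<Sum>e | card e = l. of_bool ((i, j) \<in> ordered_pairs e) * indicat_real (edge_event (l, e)) \<omega>)"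
    unfolding adj_def edge_index_def using finite_L by (subst sum.Sigma) (auto simp: case_prod_unfold)
  also have "\<dots> = (\<Sum>l\<in>L. if i \<noteq> j then \<Sum>e | card e = l \<and> {i, j} \<subseteq> e. of_bool (e \<in> H l \<omega>) else 0)"
  proof (rule sum.cong[OF refl])
    fix l
    have "(\<Sum>e | card e = l. of_bool ((i, j) \<in> ordered_pairs e) * indicat_real (edge_event (l, e)) \<omega>)
        = (\<Sum>e | card e = l \<and> {i, j} \<subseteq> e. of_bool (e \<in> H l \<omega>))" if "i \<noteq> j"
      using that assms
      by (intro sum.mono_neutral_cong_right) (auto simp: ordered_pairs_def edge_event_def indicator_def)
    then show "(\<Sum>e | card e = l. of_bool ((i, j) \<in> ordered_pairs e) * indicat_real (edge_event (l, e)) \<omega>)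
        = (if i \<noteq> j then \<Sum>e | card e = l \<and> {i, j} \<subseteq> e. of_bool (e \<in> H l \<omega>) else 0)"
      by (auto simp: ordered_pairs_def)
  qed
  also have "\<dots> = adjacency_matrix L H \<omega> $ i $ j" by (simp add: adjacency_matrix_def)
  finally show ?thesis by simp
qed

lemma matrix_expectation_eq_mean_adj:
  "matrix_expectation M (adjacency_matrix L H) $ i $ j = mean_adj (i, j)"
proof -
  have "expectation (\<lambda>\<omega>. adjacency_matrix L H \<omega> $ i $ j) = expectation (\<lambda>\<omega>. adj \<omega> (i, j))"
    by (intro Bochner_Integration.integral_cong refl adjacency_matrix_eq_adj)
  also have "\<dots> = mean_adj (i, j)"
    unfolding adj_def mean_adj_def
    by (subst Bochner_Integration.integral_sum) (auto simp: less_top[symmetric])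
  finally show ?thesis by (simp add: matrix_expectation_def)
qed

text \<open>Double counting of incidences between hyperedges and matrix positions. It turns a linear
  functional of the matrix into a sum over hyperedges, each weighted by the coefficients on its
  ordered pairs.\<close>

lemma sum_edges_eq_sum_pairs:
  fixes g :: "nat \<times> 'n set \<Rightarrow> real" and c :: "'n \<times> 'n \<Rightarrow> real"
  shows "(\<Sum>h\<in>edge_index. (\<Sum>z\<in>ordered_pairs (snd h). c z) * g h)
      = (\<Sum>z\<in>UNIV. c z * (\<Sum>h\<in>edge_index. of_bool (z \<in> ordered_pairs (snd h)) * g h))"
proof -
  have "(\<Sum>z\<in>ordered_pairs (snd h). c z) = (\<Sum>z\<in>UNIV. of_bool (z \<in> ordered_pairs (snd h)) * c z)" for h :: "nat \<times> 'n set"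
    by (rule sum.mono_neutral_cong_left) auto
  then have "(\<Sum>h\<in>edge_index. (\<Sum>z\<in>ordered_pairs (snd h). c z) * g h)
      = (\<Sum>h\<in>edge_index. \<Sum>z\<in>UNIV. c z * (of_bool (z \<in> ordered_pairs (snd h)) * g h))"
    by (simp only: sum_distrib_right mult.assoc mult.left_commute)
  also have "\<dots> = (\<Sum>z\<in>UNIV. \<Sum>h\<in>edge_index. c z * (of_bool (z \<in> ordered_pairs (snd h)) * g h))"
    by (rule sum.swap)
  finally show ?thesis by (simp only: sum_distrib_left)
qed

lemma sum_prob_edges_le:
  assumes "\<And>z. c z \<ge> 0"
  shows "(\<Sum>h\<in>edge_index. (\<Sum>z\<in>ordered_pairs (snd h). c z) * prob (edge_event h))
           \<le> Lmax * D / real CARD('n) * (\<Sum>z\<in>UNIV. c z)"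
proof -
  have "(\<Sum>z\<in>UNIV. c z * mean_adj z) \<le> (\<Sum>z\<in>UNIV. c z * (Lmax * D / real CARD('n)))"
    using assms mean_adj_le by (intro sum_mono mult_left_mono) auto
  also have "\<dots> = Lmax * D / real CARD('n) * (\<Sum>z\<in>UNIV. c z)"
    unfolding sum_distrib_left by (intro sum.cong refl) simp
  finally show ?thesis unfolding sum_edges_eq_sum_pairs mean_adj_def[symmetric] .
qed

lemma card_pairs_le_Lmax:
  assumes "h \<in> edge_index"
  shows "real (card (ordered_pairs (snd h))) \<le> Lmax\<^sup>2"
proof -
  have h: "card (snd h) \<in> L" using assms by (auto simp: edge_index_def)
  have "real (card (ordered_pairs (snd h))) \<le> (real (card (snd h)))\<^sup>2"
    using card_ordered_pairs_le[of "snd h"] by (metis of_nat_le_iff of_nat_power)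
  also have "\<dots> \<le> Lmax\<^sup>2" using L_le_Lmax[OF h] by (intro power_mono) auto
  finally show ?thesis .
qed

text \<open>With x = \<beta> / Lmax, the probability that at least x D hyperedges contain a given
  vertex is at most exp (- D (x ln x - x + 1)). The hypotheses on \<open>D\<close> and
  \<open>\<beta>\<close> push this below N^(-11), and the union over the vertices costs a factor
  N.\<close>

lemma degree_whp:
  assumes N2: "CARD('n) \<ge> 2" and c: "c > 0" and Dc: "D \<ge> c * ln (real CARD('n))"
    and \<beta>: "\<beta> > Lmax" and h\<beta>: "\<beta> / Lmax * ln (\<beta> / Lmax) - \<beta> / Lmax + 1 > 11 / c"
  shows "\<exists>B\<in>events. prob B \<le> 1 / real CARD('n) ^ 10 \<and>
    (\<forall>\<omega>\<in>space M - B. \<forall>i\<in>UNIV. (\<Sum>j\<in>UNIV. adj \<omega> (i, j)) \<le> \<beta> * D)"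
proof -
  define x where "x = \<beta> / Lmax"
  have x: "x > 1" using \<beta> Lmax_ge by (simp add: x_def field_simps)
  have "\<exists>B\<in>events. prob B \<le> 1 / real CARD('n) ^ 11 \<and>
    (\<forall>\<omega>\<in>space M - B. (\<Sum>j\<in>UNIV. adj \<omega> (i, j)) \<le> \<beta> * D)" for i
  proof -
    \<comment> \<open>ln x is the optimal Chernoff exponent for exceeding a mean \<open>D\<close> by
      the factor x.\<close>
    define a where "a = (\<lambda>h :: nat \<times> 'n set. ln x * of_bool (i \<in> snd h) :: real)"
    define B where "B = {\<omega> \<in> space M. (\<Sum>h\<in>edge_index. a h * indicat_real (edge_event h) \<omega>) \<ge> ln x * (x * D)}"
    have "(\<Sum>h\<in>edge_index. prob (edge_event h) * (exp (a h) - 1))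
        = (x - 1) * (\<Sum>h\<in>edge_index. of_bool (i \<in> snd h) * prob (edge_event h))"
      unfolding sum_distrib_left a_def using x by (intro sum.cong) auto
    also have "\<dots> \<le> (x - 1) * D" using expected_degree_le x by (intro mult_left_mono) auto
    finally have "(\<Sum>h\<in>edge_index. prob (edge_event h) * (exp (a h) - 1)) - ln x * (x * D)
        \<le> - (D * (x * ln x - x + 1))" by (simp add: algebra_simps)
    also have "\<dots> \<le> - (11 * ln (real CARD('n)))"
    proof -
      have "11 * ln (real CARD('n)) = (c * ln (real CARD('n))) * (11 / c)" using c by simp
      also have "\<dots> \<le> D * (x * ln x - x + 1)"
        using Dc h\<beta> N2 c D_nonneg by (intro mult_mono) (auto simp: x_def)
      finally show ?thesis by simp
    qed
    finally have "prob B \<le> exp (- (11 * ln (real CARD('n))))"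
      unfolding B_def using indep_events_tail_le[OF finite_edge_index indep_edges, of "ln x * (x * D)" a]
      by (meson exp_le_cancel_iff order_trans)
    also have "\<dots> = 1 / real CARD('n) ^ 11"
      using exp_of_nat_mult[of 11 "ln (real CARD('n))"] by (simp add: exp_minus inverse_eq_divide)
    finally have prob_B: "prob B \<le> 1 / real CARD('n) ^ 11" .
    have B_sets: "B \<in> events"
      using borel_measurable_sum_indep_events[OF indep_edges, of a] unfolding B_def by measurable
    have "(\<Sum>j\<in>UNIV. adj \<omega> (i, j)) \<le> \<beta> * D" if \<omega>: "\<omega> \<in> space M - B" for \<omega>
    proof -
      have "ln x * (\<Sum>h\<in>edge_index. of_bool (i \<in> snd h) * indicat_real (edge_event h) \<omega>) < ln x * (x * D)"
        using \<omega> by (simp add: B_def a_def sum_distrib_left mult.assoc not_le)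
      then have deg: "(\<Sum>h\<in>edge_index. of_bool (i \<in> snd h) * indicat_real (edge_event h) \<omega>) < x * D"
        using x by simp
      have "(\<Sum>j\<in>UNIV. adj \<omega> (i, j))
          = (\<Sum>h\<in>edge_index. (\<Sum>j\<in>UNIV. of_bool ((i, j) \<in> ordered_pairs (snd h))) * indicat_real (edge_event h) \<omega>)"
        unfolding adj_def sum_distrib_right by (rule sum.swap)
      also have "\<dots> \<le> (\<Sum>h\<in>edge_index. Lmax * (of_bool (i \<in> snd h) * indicat_real (edge_event h) \<omega>))"
      proof (rule sum_mono)
        fix h assume h: "h \<in> edge_index"
        \<comment> \<open>A hyperedge through \<open>i\<close> adds at most its size to the row sum,
          hence the loss of \<open>Lmax\<close> between \<open>x\<close> and
          \<open>\<beta>\<close>.\<close>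
        have "(\<Sum>j\<in>UNIV. of_bool ((i, j) \<in> ordered_pairs (snd h)) :: real) \<le> Lmax * of_bool (i \<in> snd h)"
        proof (cases "i \<in> snd h")
          case True
          have "(\<Sum>j\<in>UNIV. of_bool ((i, j) \<in> ordered_pairs (snd h)) :: real) \<le> (\<Sum>j\<in>UNIV. of_bool (j \<in> snd h))"
            by (intro sum_mono) (auto simp: ordered_pairs_def)
          also have "\<dots> = card (snd h)" by simp
          also have "\<dots> \<le> Lmax" using h by (intro L_le_Lmax) (auto simp: edge_index_def)
          finally show ?thesis using True by simp
        qed (simp add: ordered_pairs_def)
        then show "(\<Sum>j\<in>UNIV. of_bool ((i, j) \<in> ordered_pairs (snd h))) * indicat_real (edge_event h) \<omega>
            \<le> Lmax * (of_bool (i \<in> snd h) * indicat_real (edge_event h) \<omega>)"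
          by (simp only: mult.assoc[symmetric]) (intro mult_right_mono, auto)
      qed
      also have "\<dots> = Lmax * (\<Sum>h\<in>edge_index. of_bool (i \<in> snd h) * indicat_real (edge_event h) \<omega>)"
        by (simp only: sum_distrib_left)
      also have "\<dots> \<le> Lmax * (x * D)" using deg Lmax_ge by (intro mult_left_mono) auto
      also have "\<dots> = \<beta> * D" using Lmax_ge by (simp add: x_def)
      finally show ?thesis .
    qed
    then show ?thesis using prob_B by (intro bexI[OF _ B_sets]) blast
  qed
  then have "\<exists>B\<in>events. prob B \<le> (\<Sum>i\<in>(UNIV :: 'n set). 1 / real CARD('n) ^ 11) \<and>
    (\<forall>\<omega>\<in>space M - B. \<forall>i\<in>UNIV. (\<Sum>j\<in>UNIV. adj \<omega> (i, j)) \<le> \<beta> * D)"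
    by (intro finite_union_exceptional_event) auto
  moreover have "(\<Sum>i\<in>(UNIV :: 'n set). 1 / real CARD('n) ^ 11) = 1 / real CARD('n) ^ 10" by (simp add: power_eq_if)
  ultimately show ?thesis by simp
qed

text \<open>For fixed S and T a hyperedge has weight at most Lmax^2 in the edge count, whose mean is
  at most Lmax D |S| |T| / N. The cost in the bound, seven copies for each set, pays for the union
  over all pairs (S, T).\<close>

lemma discrepancy_whp:
  "\<exists>B\<in>events. prob B \<le> 1 / real CARD('n) ^ 10 \<and>
    (\<forall>\<omega>\<in>space M - B. \<forall>p\<in>{S. S \<noteq> {}} \<times> {S. S \<noteq> {}}. \<forall>\<theta>>0.
      \<theta> * (\<Sum>i\<in>fst p. \<Sum>j\<in>snd p. adj \<omega> (i, j))
        \<le> Lmax * D / real CARD('n) * real (card (fst p)) * real (card (snd p)) * (exp \<theta> - 1)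
          + 7 * Lmax\<^sup>2 * (set_cost (real CARD('n)) (card (fst p)) + set_cost (real CARD('n)) (card (snd p))))"
proof -
  define m where "m = Lmax\<^sup>2"
  have m: "m > 0" using Lmax_ge by (simp add: m_def)
  let ?w = "\<lambda>S. set_cost (real CARD('n)) (real (card S))"
  let ?X = "{S :: 'n set. S \<noteq> {}}"
  have "\<exists>B\<in>events. prob B \<le> exp (- 7 * ?w (fst p)) * exp (- 7 * ?w (snd p)) \<and> (\<forall>\<omega>\<in>space M - B. \<forall>\<theta>>0.
      \<theta> * (\<Sum>i\<in>fst p. \<Sum>j\<in>snd p. adj \<omega> (i, j))
        \<le> Lmax * D / real CARD('n) * real (card (fst p)) * real (card (snd p)) * (exp \<theta> - 1)
          + 7 * Lmax\<^sup>2 * (?w (fst p) + ?w (snd p)))" for p :: "'n set \<times> 'n set"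
  proof -
    obtain S T where p: "p = (S, T)" by (cases p)
    define w where "w = (\<lambda>h :: nat \<times> 'n set. card (ordered_pairs (snd h) \<inter> S \<times> T))"
    define \<delta> where "\<delta> = Lmax * D / real CARD('n) * real (card S) * real (card T)"
    define K where "K = 7 * (?w S + ?w T)"
    have w_sum: "real (w h) = (\<Sum>z\<in>ordered_pairs (snd h). indicat_real (S \<times> T) z)" for h
      unfolding w_def by (simp add: indicator_def sum.If_cases Int_def)
    have ind_sum: "(\<Sum>z\<in>UNIV. indicat_real (S \<times> T) z * f z) = (\<Sum>i\<in>S. \<Sum>j\<in>T. f (i, j))" for f
    proof -
      have "(\<Sum>z\<in>UNIV. indicat_real (S \<times> T) z * f z) = (\<Sum>z\<in>S \<times> T. f z)"
        by (rule sum.mono_neutral_cong_right) auto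
      then show ?thesis by (simp add: sum.cartesian_product)
    qed
    have mean: "(\<Sum>h\<in>edge_index. w h * prob (edge_event h)) \<le> \<delta>"
      using sum_prob_edges_le[of "indicat_real (S \<times> T)"] ind_sum[of "\<lambda>_. 1"]
      by (simp add: w_sum \<delta>_def mult_ac)
    have "(\<Sum>h\<in>edge_index. prob (edge_event h) * (exp (r * w h) - 1)) \<le> \<delta> * (exp (r * m) - 1) / m"
      if r: "r > 0" for r :: real
    proof -
      have "(\<Sum>h\<in>edge_index. prob (edge_event h) * (exp (r * w h) - 1))
          \<le> (\<Sum>h\<in>edge_index. prob (edge_event h) * (w h / m * (exp (r * m) - 1)))"
      proof (intro sum_mono mult_left_mono exp_convex_chord)
        fix h assume h: "h \<in> edge_index"
        have "w h \<le> card (ordered_pairs (snd h))" unfolding w_def by (intro card_mono) auto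
        then show "real (w h) \<le> m" using card_pairs_le_Lmax[OF h] by (simp add: m_def)
      qed (use m in auto)
      also have "\<dots> = (exp (r * m) - 1) / m * (\<Sum>h\<in>edge_index. w h * prob (edge_event h))"
        unfolding sum_distrib_left by (intro sum.cong) auto
      also have "\<dots> \<le> (exp (r * m) - 1) / m * \<delta>"
        using mean m r by (intro mult_left_mono) auto
      finally show ?thesis by (simp add: mult.commute)
    qed
    from indep_events_uniform_chernoff[OF finite_edge_index indep_edges this, where K = K]
    obtain B where B: "B \<in> events" "prob B \<le> exp (- K)"
      and B3: "\<And>\<omega> r. \<omega> \<in> space M - B \<Longrightarrow> r > 0 \<Longrightarrow>
        r * (\<Sum>h\<in>edge_index. w h * indicat_real (edge_event h) \<omega>) \<le> \<delta> * (exp (r * m) - 1) / m + K"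
      by blast
    have "\<theta> * (\<Sum>i\<in>S. \<Sum>j\<in>T. adj \<omega> (i, j)) \<le> \<delta> * (exp \<theta> - 1) + m * K"
      if \<omega>: "\<omega> \<in> space M - B" and \<theta>: "\<theta> > 0" for \<omega> \<theta>
    proof -
      have "(\<Sum>h\<in>edge_index. w h * indicat_real (edge_event h) \<omega>) = (\<Sum>i\<in>S. \<Sum>j\<in>T. adj \<omega> (i, j))"
        unfolding w_sum sum_edges_eq_sum_pairs adj_def[symmetric] by (rule ind_sum)
      \<comment> \<open>The exponent is rescaled by the largest weight \<open>m\<close>, so that exp
        (r * m) becomes exp \<theta>; multiplying back by \<open>m\<close> puts Lmax^2 in front of
        the set costs.\<close>
      then have "\<theta> / m * (\<Sum>i\<in>S. \<Sum>j\<in>T. adj \<omega> (i, j)) \<le> \<delta> * (exp \<theta> - 1) / m + K"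
        using B3[OF \<omega>, of "\<theta> / m"] \<theta> m by simp
      then have "m * (\<theta> / m * (\<Sum>i\<in>S. \<Sum>j\<in>T. adj \<omega> (i, j))) \<le> m * (\<delta> * (exp \<theta> - 1) / m + K)"
        using m by (intro mult_left_mono) auto
      then show ?thesis using m by (simp add: distrib_left)
    qed
    moreover have "exp (- K) = exp (- 7 * ?w S) * exp (- 7 * ?w T)"
      by (simp add: K_def flip: exp_add)
    moreover have "m * K = 7 * Lmax\<^sup>2 * (?w S + ?w T)" by (simp add: m_def K_def)
    ultimately show ?thesis
      using B(2) unfolding p fst_conv snd_conv \<delta>_def[symmetric] by (intro bexI[OF _ B(1)]) simp
  qed
  then have "\<exists>B\<in>events. prob B \<le> (\<Sum>p\<in>?X \<times> ?X. exp (- 7 * ?w (fst p)) * exp (- 7 * ?w (snd p))) \<and>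
    (\<forall>\<omega>\<in>space M - B. \<forall>p\<in>?X \<times> ?X. \<forall>\<theta>>0.
      \<theta> * (\<Sum>i\<in>fst p. \<Sum>j\<in>snd p. adj \<omega> (i, j))
        \<le> Lmax * D / real CARD('n) * real (card (fst p)) * real (card (snd p)) * (exp \<theta> - 1)
          + 7 * Lmax\<^sup>2 * (?w (fst p) + ?w (snd p)))"
    by (intro finite_union_exceptional_event) auto
  moreover have "(\<Sum>p\<in>?X \<times> ?X. exp (- 7 * ?w (fst p)) * exp (- 7 * ?w (snd p))) \<le> 1 / real CARD('n) ^ 10"
  proof -
    have "(\<Sum>p\<in>?X \<times> ?X. exp (- 7 * ?w (fst p)) * exp (- 7 * ?w (snd p)))
        = (\<Sum>S\<in>?X. exp (- 7 * ?w S)) * (\<Sum>S\<in>?X. exp (- 7 * ?w S))"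
      unfolding sum_product by (simp add: sum.cartesian_product case_prod_unfold)
    also have "\<dots> \<le> 1 / real CARD('n) ^ 5 * (1 / real CARD('n) ^ 5)"
      using sum_exp_set_cost_le[where 'n = 'n] by (intro mult_mono sum_nonneg) auto
    also have "\<dots> = 1 / real CARD('n) ^ 10" by (simp flip: power_add)
    finally show ?thesis .
  qed
  ultimately show ?thesis by (meson order_trans)
qed

definition light :: "real^'n \<Rightarrow> ('n \<times> 'n) set" where
  "light x = {(i, j). \<bar>x $ i\<bar> * \<bar>x $ j\<bar> \<le> sqrt D / real CARD('n)}"

lemma light_whp:
  fixes x :: "real^'n"
  assumes x: "norm x = 1" and D0: "D > 0"
  shows "\<exists>B\<in>events. prob B \<le> 2 * exp (- 9 / 2 * real CARD('n)) \<and>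
    (\<forall>\<omega>\<in>space M - B. \<bar>\<Sum>(i, j)\<in>light x. (adj \<omega> (i, j) - mean_adj (i, j)) * x $ i * x $ j\<bar> \<le> 5 * Lmax\<^sup>2 * sqrt D)"
proof -
  define c where "c = (\<lambda>z. if z \<in> light x then x $ fst z * x $ snd z else 0)"
  define y where "y = (\<lambda>h :: nat \<times> 'n set. \<Sum>z\<in>ordered_pairs (snd h). c z)"
  define m where "m = Lmax\<^sup>2"
  \<comment> \<open>A hyperedge has at most \<open>m\<close> ordered pairs, each with coefficient at
    most sqrt D / N, so this \<open>r\<close> keeps the summands within [-1, 1]. It turns the
    variance bound into N / Lmax \<le> N / 2 and the deviation into 5 N, leaving the rate 9 /
    2.\<close>
  define r where "r = real CARD('n) / (m * sqrt D)"
  \<comment> \<open>The sign \<open>s\<close> lets one upper tail bound serve for both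
    tails.\<close>
  define Y where "Y = (\<lambda>(s :: real) \<omega>. \<Sum>h\<in>edge_index. (s * y h) * (indicat_real (edge_event h) \<omega> - prob (edge_event h)))"
  have m: "m > 0" using Lmax_ge by (simp add: m_def)
  have r: "r > 0" using m D0 by (simp add: r_def)
  have c_le: "\<bar>c z\<bar> \<le> sqrt D / real CARD('n)" for z
    using D0 by (auto simp: c_def light_def abs_mult)
  have y_le: "\<bar>r * y h\<bar> \<le> 1" if h: "h \<in> edge_index" for h
  proof -
    have "\<bar>y h\<bar> \<le> (\<Sum>z\<in>ordered_pairs (snd h). sqrt D / real CARD('n))"
      unfolding y_def using c_le by (intro order_trans[OF sum_abs sum_mono])
    also have "\<dots> \<le> m * (sqrt D / real CARD('n))"
      using card_pairs_le_Lmax[OF h] D0 unfolding sum_constant m_def by (intro mult_right_mono) auto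
    also have "\<dots> = 1 / r" by (simp add: r_def)
    finally show ?thesis using r by (simp add: abs_mult pos_le_divide_eq mult.commute)
  qed
  have x2: "(\<Sum>i\<in>UNIV. (x $ i)\<^sup>2) = 1"
    using x by (simp add: norm_vec_def L2_set_def)
  have c2: "(\<Sum>z\<in>UNIV. (c z)\<^sup>2) \<le> 1"
  proof -
    have "(\<Sum>z\<in>UNIV. (c z)\<^sup>2) \<le> (\<Sum>z\<in>UNIV \<times> UNIV. (x $ fst z)\<^sup>2 * (x $ snd z)\<^sup>2)"
      unfolding UNIV_Times_UNIV by (intro sum_mono) (auto simp: c_def power_mult_distrib)
    also have "\<dots> = (\<Sum>i\<in>UNIV. (x $ i)\<^sup>2) * (\<Sum>i\<in>UNIV. (x $ i)\<^sup>2)"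
      unfolding sum_product sum.cartesian_product by (simp add: case_prod_unfold)
    finally show ?thesis using x2 by simp
  qed
  have var: "(\<Sum>h\<in>edge_index. prob (edge_event h) * (y h)\<^sup>2) \<le> m * (Lmax * D / real CARD('n))"
  proof -
    have "(\<Sum>h\<in>edge_index. prob (edge_event h) * (y h)\<^sup>2)
        \<le> (\<Sum>h\<in>edge_index. m * ((\<Sum>z\<in>ordered_pairs (snd h). (c z)\<^sup>2) * prob (edge_event h)))"
    proof (rule sum_mono)
      fix h assume h: "h \<in> edge_index"
      \<comment> \<open>Cauchy-Schwarz over the ordered pairs of one hyperedge absorbs the
        dependence between its matrix entries.\<close>
      have "(y h)\<^sup>2 \<le> (\<Sum>z\<in>ordered_pairs (snd h). (c z)\<^sup>2) * card (ordered_pairs (snd h))"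
        unfolding y_def by (rule sum_squared_le_sum_of_squares)
      also have "\<dots> \<le> (\<Sum>z\<in>ordered_pairs (snd h). (c z)\<^sup>2) * m"
        using card_pairs_le_Lmax[OF h] unfolding m_def by (intro mult_left_mono sum_nonneg) auto
      finally have "prob (edge_event h) * (y h)\<^sup>2 \<le> prob (edge_event h) * ((\<Sum>z\<in>ordered_pairs (snd h). (c z)\<^sup>2) * m)"
        by (intro mult_left_mono) auto
      then show "prob (edge_event h) * (y h)\<^sup>2 \<le> m * ((\<Sum>z\<in>ordered_pairs (snd h). (c z)\<^sup>2) * prob (edge_event h))"
        by (simp only: mult_ac)
    qed
    also have "\<dots> \<le> m * (Lmax * D / real CARD('n) * (\<Sum>z\<in>UNIV. (c z)\<^sup>2))"
      unfolding sum_distrib_left[symmetric] using m by (intro mult_left_mono sum_prob_edges_le) auto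
    also have "\<dots> \<le> m * (Lmax * D / real CARD('n) * 1)"
      using c2 m D0 by (intro mult_left_mono) auto
    finally show ?thesis by simp
  qed
  define B where "B = {\<omega> \<in> space M. Y 1 \<omega> \<ge> 5 * m * sqrt D} \<union> {\<omega> \<in> space M. Y (- 1) \<omega> \<ge> 5 * m * sqrt D}"
  have tail: "prob {\<omega> \<in> space M. Y s \<omega> \<ge> 5 * m * sqrt D} \<le> exp (- 9 / 2 * real CARD('n))" if s: "s \<in> {1, - 1}" for s
  proof -
    have "prob {\<omega> \<in> space M. Y s \<omega> \<ge> 5 * m * sqrt D}
        \<le> exp (r\<^sup>2 * (m * (Lmax * D / real CARD('n))) - r * (5 * m * sqrt D))"
      unfolding Y_def
      by (rule indep_events_centered_tail_le[OF finite_edge_index indep_edges r]) (use y_le var s in auto)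
    also have "r * (5 * m * sqrt D) = 5 * real CARD('n)" using m D0 by (simp add: r_def)
    also have "r\<^sup>2 * (m * (Lmax * D / real CARD('n))) = real CARD('n) / Lmax"
    proof -
      have "r\<^sup>2 = (real CARD('n))\<^sup>2 / (m\<^sup>2 * D)"
        using D0 by (simp add: r_def power_divide power_mult_distrib)
      then show ?thesis using m D0 Lmax_ge by (simp add: m_def power2_eq_square)
    qed
    also have "exp (real CARD('n) / Lmax - 5 * real CARD('n)) \<le> exp (- 9 / 2 * real CARD('n))"
    proof -
      have "real CARD('n) / Lmax \<le> real CARD('n) / 2" using Lmax_ge by (intro divide_left_mono) auto
      then show ?thesis unfolding exp_le_cancel_iff by linarith
    qed
    finally show ?thesis .
  qed
  have meas: "{\<omega> \<in> space M. Y s \<omega> \<ge> t} \<in> events" for s t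
  proof -
    have "Y s \<in> borel_measurable M"
      unfolding Y_def by (intro borel_measurable_sum borel_measurable_times borel_measurable_diff
          borel_measurable_const borel_measurable_indicator edge_event_sets)
    then show ?thesis by measurable
  qed
  have "prob B \<le> exp (- 9 / 2 * real CARD('n)) + exp (- 9 / 2 * real CARD('n))"
    unfolding B_def by (intro order_trans[OF measure_Un_le] add_mono tail meas) auto
  then have prob_B: "prob B \<le> 2 * exp (- 9 / 2 * real CARD('n))" by simp
  have B_sets: "B \<in> events" unfolding B_def by (intro sets.Un meas)
  have "\<bar>\<Sum>(i, j)\<in>light x. (adj \<omega> (i, j) - mean_adj (i, j)) * x $ i * x $ j\<bar> \<le> 5 * Lmax\<^sup>2 * sqrt D"
    if \<omega>: "\<omega> \<in> space M - B" for \<omega>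
  proof -
    have diff: "adj \<omega> z - mean_adj z = (\<Sum>h\<in>edge_index. of_bool (z \<in> ordered_pairs (snd h)) *
        (indicat_real (edge_event h) \<omega> - prob (edge_event h)))" for z
      unfolding adj_def mean_adj_def by (simp add: sum_subtractf right_diff_distrib)
    have "(\<Sum>(i, j)\<in>light x. (adj \<omega> (i, j) - mean_adj (i, j)) * x $ i * x $ j)
        = (\<Sum>z\<in>UNIV. c z * (adj \<omega> z - mean_adj z))"
      by (rule sum.mono_neutral_cong_left) (auto simp: c_def)
    also have "\<dots> = Y 1 \<omega>"
      unfolding diff sum_edges_eq_sum_pairs[symmetric] by (simp add: Y_def y_def)
    finally have eq: "(\<Sum>(i, j)\<in>light x. (adj \<omega> (i, j) - mean_adj (i, j)) * x $ i * x $ j) = Y 1 \<omega>" .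
    have "Y (- 1) \<omega> = - Y 1 \<omega>" by (simp add: Y_def sum_negf)
    then show ?thesis using \<omega> unfolding eq by (auto simp: B_def m_def)
  qed
  then show ?thesis using prob_B by (intro bexI[OF _ B_sets]) blast
qed

end

text \<open>The set is a finite union of atoms of the algebra generated by the events. This gives
  measurability of the spectral norm event, since A depends only on which hyperedges are
  present.\<close>

lemma (in prob_space) sets_determined_by_finitely_many_events:
  assumes fin: "finite I" and E: "\<And>h. h \<in> I \<Longrightarrow> E h \<in> events"
    and cong: "\<And>\<omega> \<omega>'. \<omega> \<in> space M \<Longrightarrow> \<omega>' \<in> space M \<Longrightarrow>
      (\<And>h. h \<in> I \<Longrightarrow> \<omega> \<in> E h \<longleftrightarrow> \<omega>' \<in> E h) \<Longrightarrow> P \<omega> \<Longrightarrow> P \<omega>'"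
  shows "{\<omega> \<in> space M. P \<omega>} \<in> events"
proof -
  define conf where "conf = (\<lambda>\<omega>. {h \<in> I. \<omega> \<in> E h})"
  define X where "X = conf ` {\<omega> \<in> space M. P \<omega>}"
  have "X \<subseteq> Pow I" by (auto simp: X_def conf_def)
  then have finX: "finite X" using fin by (meson finite_Pow_iff finite_subset)
  have "{\<omega> \<in> space M. P \<omega>} = (\<Union>J\<in>X. {\<omega> \<in> space M. \<forall>h\<in>I. \<omega> \<in> E h \<longleftrightarrow> h \<in> J})"
  proof (intro equalityI subsetI)
    fix \<omega> assume "\<omega> \<in> {\<omega> \<in> space M. P \<omega>}"
    then show "\<omega> \<in> (\<Union>J\<in>X. {\<omega> \<in> space M. \<forall>h\<in>I. \<omega> \<in> E h \<longleftrightarrow> h \<in> J})"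
      by (auto simp: X_def conf_def)
  next
    fix \<omega> assume "\<omega> \<in> (\<Union>J\<in>X. {\<omega> \<in> space M. \<forall>h\<in>I. \<omega> \<in> E h \<longleftrightarrow> h \<in> J})"
    then obtain \<omega>' where "\<omega> \<in> space M" "\<omega>' \<in> space M" "P \<omega>'" "\<forall>h\<in>I. \<omega> \<in> E h \<longleftrightarrow> h \<in> conf \<omega>'"
      by (auto simp: X_def)
    then show "\<omega> \<in> {\<omega> \<in> space M. P \<omega>}" using cong[of \<omega>' \<omega>] by (auto simp: conf_def)
  qed
  moreover have "{\<omega> \<in> space M. \<forall>h\<in>I. \<omega> \<in> E h \<longleftrightarrow> h \<in> J} \<in> events" for J
  proof (rule sets.sets_Collect_finite_All[OF _ fin])
    fix h assume "h \<in> I"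
    then have "E h \<in> events" by (rule E)
    then show "{\<omega> \<in> space M. \<omega> \<in> E h \<longleftrightarrow> h \<in> J} \<in> events" by measurable
  qed
  ultimately show ?thesis using finX by auto
qed

section \<open>Heavy pairs of the random matrix and combination of the exceptional events\<close>

context inhomogeneous_ER_hypergraph
begin

text \<open>On heavy pairs no cancellation between A and EA is exploited: each is bounded separately
  in terms of the absolute values of the coordinates.\<close>

lemma heavy_le:
  fixes x :: "real^'n"
  assumes x: "norm x = 1" and D0: "D > 0" and \<beta>: "\<beta> > Lmax"
    and rows: "\<And>i. (\<Sum>j\<in>UNIV. adj \<omega> (i, j)) \<le> \<beta> * D"
    and disc: "\<And>S T \<theta>. S \<noteq> {} \<Longrightarrow> T \<noteq> {} \<Longrightarrow> \<theta> > 0 \<Longrightarrow>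
      \<theta> * (\<Sum>i\<in>S. \<Sum>j\<in>T. adj \<omega> (i, j))
        \<le> Lmax * D / real CARD('n) * real (card S) * real (card T) * (exp \<theta> - 1)
          + 7 * Lmax\<^sup>2 * (set_cost (real CARD('n)) (card S) + set_cost (real CARD('n)) (card T))"
  shows "\<bar>\<Sum>(i, j)\<in>- light x. (adj \<omega> (i, j) - mean_adj (i, j)) * x $ i * x $ j\<bar>
    \<le> ((16 + 32 * Lmax * (1 + exp 2) + 1792 * (1 + exp (- 2)) * Lmax\<^sup>2) * sqrt \<beta> + Lmax) * sqrt D"
proof -
  define a where "a = (\<lambda>i. \<bar>x $ i\<bar>)"
  have \<beta>1: "\<beta> \<ge> 1" using \<beta> Lmax_ge by simp
  have L0: "Lmax > 0" using Lmax_ge by simp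
  have x2: "(\<Sum>i\<in>UNIV. (a i)\<^sup>2) = 1"
    using x by (simp add: norm_vec_def L2_set_def a_def)
  have heavy: "- light x = {(i, j). a i * a j > sqrt D / real CARD('n)}"
    by (auto simp: light_def a_def)
  have "(\<Sum>(i, j)\<in>- light x. adj \<omega> (i, j) * a i * a j)
      \<le> (2 + 16 * exp 1 * Lmax + 5488 / 3 * Lmax\<^sup>2) * sqrt (\<beta> * D)"
    unfolding heavy
    by (rule heavy_sum_le[OF adj_nonneg adj_sym _ x2 D0 \<beta>1 _ refl rows disc])
      (use Lmax_ge in \<open>auto simp: a_def\<close>)
  also have "\<dots> \<le> (16 + 32 * Lmax * (1 + exp 2) + 1792 * (1 + exp (- 2)) * Lmax\<^sup>2) * sqrt (\<beta> * D)"
  proof (rule mult_right_mono)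
    have e2: "exp (2 :: real) = exp 1 * exp 1" by (simp flip: exp_add)
    have "exp (2 :: real) \<le> 3 * 3" unfolding e2 using exp_le by (intro mult_mono) auto
    \<comment> \<open>5488 / 3 is slightly larger than 1792, so the summand exp (- 2) is used here;
      1792 * 10 / 9 suffices.\<close>
    then have "1 / 9 \<le> exp (- 2 :: real)" by (simp add: exp_minus inverse_eq_divide frac_le)
    then have "5488 / 3 * Lmax\<^sup>2 \<le> 1792 * (1 + exp (- 2)) * Lmax\<^sup>2"
      by (intro mult_right_mono) auto
    moreover have "16 * exp 1 * Lmax \<le> 32 * Lmax * (1 + exp 2)"
    proof -
      have "16 * exp 1 \<le> 32 * (1 + exp (2 :: real))" proof -
        have "16 * exp (1 :: real) \<le> 32 * exp 2" by (intro mult_mono) auto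
        also have "\<dots> \<le> 32 * (1 + exp 2)" by simp
        finally show ?thesis .
      qed
      then show ?thesis using mult_right_mono[of "16 * exp 1" "32 * (1 + exp 2)" Lmax] L0 by (simp add: mult_ac)
    qed
    ultimately show "2 + 16 * exp 1 * Lmax + 5488 / 3 * Lmax\<^sup>2
        \<le> 16 + 32 * Lmax * (1 + exp 2) + 1792 * (1 + exp (- 2)) * Lmax\<^sup>2" by linarith
  qed (use \<beta>1 D0 in simp)
  finally have A: "(\<Sum>(i, j)\<in>- light x. adj \<omega> (i, j) * a i * a j)
      \<le> (16 + 32 * Lmax * (1 + exp 2) + 1792 * (1 + exp (- 2)) * Lmax\<^sup>2) * sqrt \<beta> * sqrt D"
    by (simp add: real_sqrt_mult mult.assoc)
  \<comment> \<open>Heaviness gives sqrt D / N \<le> a_i a_j, so one factor sqrt D / N of the entry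
    bound Lmax D / N is replaced by a_i a_j, and the squares sum to 1. This is the summand
    \<open>Lmax\<close> of \<open>b\<close>.\<close>
  have EA: "(\<Sum>(i, j)\<in>- light x. mean_adj (i, j) * a i * a j) \<le> Lmax * sqrt D"
  proof -
    have "(\<Sum>(i, j)\<in>- light x. mean_adj (i, j) * a i * a j)
        \<le> (\<Sum>(i, j)\<in>- light x. Lmax * sqrt D * ((a i)\<^sup>2 * (a j)\<^sup>2))"
    proof (rule sum_mono, clarify)
      fix i j assume "(i, j) \<notin> light x"
      then have big: "sqrt D / real CARD('n) \<le> a i * a j" by (simp add: light_def a_def)
      have a0: "a i * a j \<ge> 0" by (simp add: a_def)
      have "mean_adj (i, j) * (a i * a j) \<le> Lmax * D / real CARD('n) * (a i * a j)"
        using mean_adj_le a0 by (rule mult_right_mono)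
      also have "\<dots> = Lmax * sqrt D * (sqrt D / real CARD('n)) * (a i * a j)"
        using D0 by simp
      also have "\<dots> \<le> Lmax * sqrt D * (a i * a j) * (a i * a j)"
        using big a0 D0 L0 by (intro mult_right_mono mult_left_mono) auto
      finally show "mean_adj (i, j) * a i * a j \<le> Lmax * sqrt D * ((a i)\<^sup>2 * (a j)\<^sup>2)"
        by (simp add: power2_eq_square mult_ac)
    qed
    also have "\<dots> \<le> (\<Sum>(i, j)\<in>UNIV \<times> UNIV. Lmax * sqrt D * ((a i)\<^sup>2 * (a j)\<^sup>2))"
      using L0 D0 by (intro sum_mono2) auto
    also have "\<dots> = Lmax * sqrt D * ((\<Sum>i\<in>UNIV. (a i)\<^sup>2) * (\<Sum>i\<in>UNIV. (a i)\<^sup>2))"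
      unfolding sum_product sum.cartesian_product by (simp add: sum_distrib_left case_prod_unfold)
    finally show ?thesis using x2 by simp
  qed
  have "\<bar>\<Sum>(i, j)\<in>- light x. (adj \<omega> (i, j) - mean_adj (i, j)) * x $ i * x $ j\<bar>
      \<le> (\<Sum>(i, j)\<in>- light x. adj \<omega> (i, j) * a i * a j + mean_adj (i, j) * a i * a j)"
  proof (rule order_trans[OF sum_abs sum_mono], clarify)
    fix i j
    have "\<bar>adj \<omega> (i, j) - mean_adj (i, j)\<bar> \<le> adj \<omega> (i, j) + mean_adj (i, j)"
      using adj_nonneg[of \<omega> "(i, j)"] mean_adj_nonneg[of "(i, j)"] by linarith
    then have "\<bar>adj \<omega> (i, j) - mean_adj (i, j)\<bar> * (a i * a j) \<le> (adj \<omega> (i, j) + mean_adj (i, j)) * (a i * a j)"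
      by (rule mult_right_mono) (simp add: a_def)
    then show "\<bar>(adj \<omega> (i, j) - mean_adj (i, j)) * x $ i * x $ j\<bar>
        \<le> adj \<omega> (i, j) * a i * a j + mean_adj (i, j) * a i * a j"
      by (simp add: abs_mult a_def distrib_right mult.assoc)
  qed
  also have "\<dots> = (\<Sum>(i, j)\<in>- light x. adj \<omega> (i, j) * a i * a j) + (\<Sum>(i, j)\<in>- light x. mean_adj (i, j) * a i * a j)"
    by (simp add: sum.distrib case_prod_unfold)
  finally show ?thesis using A EA by (simp add: distrib_right)
qed

lemma spectral_norm_event:
  "{\<omega> \<in> space M. spectral_norm (adjacency_matrix L H \<omega> - B) \<le> t} \<in> events"
proof (rule sets_determined_by_finitely_many_events[OF finite_edge_index edge_event_sets])
  fix \<omega> \<omega>'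
  assume \<omega>: "\<omega> \<in> space M" "\<omega>' \<in> space M"
    and same: "\<And>h. h \<in> edge_index \<Longrightarrow> \<omega> \<in> edge_event h \<longleftrightarrow> \<omega>' \<in> edge_event h"
    and le: "spectral_norm (adjacency_matrix L H \<omega> - B) \<le> t"
  have "adj \<omega> z = adj \<omega>' z" for z
    unfolding adj_def using same by (intro sum.cong) (auto simp: indicator_def)
  then have "adjacency_matrix L H \<omega> = adjacency_matrix L H \<omega>'"
    using \<omega> by (simp add: vec_eq_iff adjacency_matrix_eq_adj)
  with le show "spectral_norm (adjacency_matrix L H \<omega>' - B) \<le> t" by simp
qed

lemma spectral_norm_whp:
  assumes N2: "CARD('n) \<ge> 2" and c: "c > 0" and Dc: "D \<ge> c * ln (real CARD('n))"
    and \<beta>: "\<beta> > Lmax" and h\<beta>: "\<beta> / Lmax * ln (\<beta> / Lmax) - \<beta> / Lmax + 1 > 11 / c"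
  defines "b \<equiv> (16 + 32 * Lmax * (1 + exp 2) + 1792 * (1 + exp (- 2)) * Lmax\<^sup>2) * sqrt \<beta> + Lmax"
  shows "prob {\<omega> \<in> space M.
      spectral_norm (adjacency_matrix L H \<omega> - matrix_expectation M (adjacency_matrix L H))
        \<le> (10 * Lmax\<^sup>2 + 2 * b) * sqrt D}
    \<ge> 1 - 2 / real CARD('n) ^ 10 - 2 * exp (- real CARD('n))"
proof -
  let ?N = "real CARD('n)"
  let ?G = "{\<omega> \<in> space M.
      spectral_norm (adjacency_matrix L H \<omega> - matrix_expectation M (adjacency_matrix L H))
        \<le> (10 * Lmax\<^sup>2 + 2 * b) * sqrt D}"
  have "0 < c * ln ?N" using c N2 by simp
  then have D0: "D > 0" using Dc by simp
  obtain S :: "(real^'n) set" where S: "finite S" "S \<subseteq> sphere 0 1" "real (card S) \<le> 9 ^ DIM(real^'n)"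
    and net: "\<forall>x. norm x = 1 \<longrightarrow> (\<exists>y\<in>S. dist x y \<le> 1 / 4)"
    by (rule exists_sphere_net[where 'a = "real^'n"])
  obtain B1 where B1: "B1 \<in> events" "prob B1 \<le> 1 / ?N ^ 10"
    and rows: "\<And>\<omega> i. \<omega> \<in> space M - B1 \<Longrightarrow> (\<Sum>j\<in>UNIV. adj \<omega> (i, j)) \<le> \<beta> * D"
    using degree_whp[OF N2 c Dc \<beta> h\<beta>] by blast
  obtain B2 where B2: "B2 \<in> events" "prob B2 \<le> 1 / ?N ^ 10"
    and disc: "\<And>\<omega> S T \<theta>. \<omega> \<in> space M - B2 \<Longrightarrow> S \<noteq> {} \<Longrightarrow> T \<noteq> {} \<Longrightarrow> \<theta> > 0 \<Longrightarrow>
      \<theta> * (\<Sum>i\<in>S. \<Sum>j\<in>T. adj \<omega> (i, j))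
        \<le> Lmax * D / ?N * real (card S) * real (card T) * (exp \<theta> - 1)
          + 7 * Lmax\<^sup>2 * (set_cost ?N (card S) + set_cost ?N (card T))"
    using discrepancy_whp by fastforce
  have "\<exists>B\<in>events. prob B \<le> (\<Sum>x\<in>S. 2 * exp (- 9 / 2 * ?N)) \<and> (\<forall>\<omega>\<in>space M - B. \<forall>x\<in>S.
      \<bar>\<Sum>(i, j)\<in>light x. (adj \<omega> (i, j) - mean_adj (i, j)) * x $ i * x $ j\<bar> \<le> 5 * Lmax\<^sup>2 * sqrt D)"
    using S D0 by (intro finite_union_exceptional_event light_whp) auto
  then obtain B3 where B3: "B3 \<in> events" "prob B3 \<le> (\<Sum>x\<in>S. 2 * exp (- 9 / 2 * ?N))"
    and light: "\<And>\<omega> x. \<omega> \<in> space M - B3 \<Longrightarrow> x \<in> S \<Longrightarrow>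
      \<bar>\<Sum>(i, j)\<in>light x. (adj \<omega> (i, j) - mean_adj (i, j)) * x $ i * x $ j\<bar> \<le> 5 * Lmax\<^sup>2 * sqrt D"
    by blast
  have B3': "prob B3 \<le> 2 * exp (- ?N)"
  proof -
    \<comment> \<open>The rate 9 / 2 and the target exp (- N) leave 7 / 2 for the logarithm of 9,
      verified through exp (1 / 2) \<ge> 3 / 2.\<close>
    have "(9 :: real) \<le> (3 / 2) ^ 7" by (simp add: power_divide)
    also have "\<dots> \<le> exp (1 / 2) ^ 7"
      using exp_ge_add_one_self[of "1 / 2 :: real"] by (intro power_mono) auto
    also have "\<dots> = exp (7 / 2)" using exp_of_nat_mult[of 7 "1 / 2 :: real"] by simp
    finally have "9 ^ CARD('n) \<le> exp (7 / 2 :: real) ^ CARD('n)" by (intro power_mono) auto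
    then have "9 ^ CARD('n) \<le> exp (?N * (7 / 2))" by (simp only: exp_of_nat_mult)
    moreover have "real (card S) \<le> 9 ^ CARD('n)" using S(3) unfolding DIM_cart DIM_real mult_1_right .
    ultimately have "real (card S) \<le> exp (?N * (7 / 2))" by (rule order_trans[rotated])
    then have "real (card S) * (2 * exp (- 9 / 2 * ?N)) \<le> exp (?N * (7 / 2)) * (2 * exp (- 9 / 2 * ?N))"
      by (rule mult_right_mono) simp
    also have "\<dots> = 2 * exp (- ?N)" by (simp flip: exp_add)
    finally show ?thesis using B3(2) by simp
  qed
  have good: "space M - (B1 \<union> B2 \<union> B3) \<subseteq> ?G"
  proof
    fix \<omega> assume \<omega>: "\<omega> \<in> space M - (B1 \<union> B2 \<union> B3)"
    define W where "W = adjacency_matrix L H \<omega> - matrix_expectation M (adjacency_matrix L H)"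
    have W: "W $ i $ j = adj \<omega> (i, j) - mean_adj (i, j)" for i j
      using \<omega> by (simp add: W_def adjacency_matrix_eq_adj matrix_expectation_eq_mean_adj)
    have "onorm (\<lambda>x. W *v x) \<le> 2 * (5 * Lmax\<^sup>2 * sqrt D + b * sqrt D)"
    proof (rule onorm_symmetric_le_net[OF _ net[rule_format] S(2)])
      show "W $ i $ j = W $ j $ i" for i j
        using adj_sym[of \<omega> i j] mean_adj_sym[of i j] by (simp add: W)
      fix y assume y: "y \<in> S"
      then have ny: "norm y = 1" using S(2) by auto
      let ?f = "\<lambda>(i, j). (adj \<omega> (i, j) - mean_adj (i, j)) * y $ i * y $ j"
      have "y \<bullet> (W *v y) = (\<Sum>z\<in>UNIV. ?f z)"
        unfolding quadratic_form_eq_sum W by (simp add: sum.cartesian_product)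
      also have "\<dots> = (\<Sum>z\<in>light y. ?f z) + (\<Sum>z\<in>- light y. ?f z)"
        using sum.union_disjoint[of "light y" "- light y" ?f] by (simp add: Compl_partition)
      finally show "\<bar>y \<bullet> (W *v y)\<bar> \<le> 5 * Lmax\<^sup>2 * sqrt D + b * sqrt D"
        using light[of \<omega> y] y \<omega> heavy_le[OF ny D0 \<beta> rows disc, of \<omega>] unfolding b_def by simp
    qed
    then show "\<omega> \<in> ?G"
      using \<omega> by (simp add: W_def spectral_norm_def algebra_simps)
  qed
  have "prob (B1 \<union> B2 \<union> B3) \<le> prob B1 + prob B2 + prob B3"
    using measure_Un_le[of B1 M B2] measure_Un_le[of "B1 \<union> B2" M B3] B1 B2 B3
    by auto
  also have "\<dots> \<le> 2 / ?N ^ 10 + 2 * exp (- ?N)" using B1(2) B2(2) B3' by linarith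
  finally have "1 - 2 / ?N ^ 10 - 2 * exp (- ?N) \<le> 1 - prob (B1 \<union> B2 \<union> B3)" by simp
  also have "\<dots> = prob (space M - (B1 \<union> B2 \<union> B3))"
    using B1 B2 B3 by (intro prob_compl[symmetric]) auto
  also have "\<dots> \<le> prob ?G" by (rule finite_measure_mono[OF good spectral_norm_event])
  finally show ?thesis .
qed

end

theorem mainTheorem8:
  fixes M :: "'w measure"
    and L :: "nat set"
    and Q :: "nat \<Rightarrow> 'n::finite list \<Rightarrow> real"
    and H :: "nat \<Rightarrow> 'w \<Rightarrow> 'n set set"
    and c Lmax \<beta>\<^sub>0 \<beta>\<^sub>1 \<beta> C :: real
  assumes "inhomogeneous_ER_hypergraph M L Q H"
    and "c > 0"
    and "total_max_degree L Q \<ge> c * ln (real CARD('n))"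
    and "Lmax = real (Max L)"
    and "\<beta>\<^sub>1 > Lmax"
    and "\<beta>\<^sub>1 / Lmax * ln (\<beta>\<^sub>1 / Lmax) - \<beta>\<^sub>1 / Lmax + 1 > 11 / c"
    and "\<beta>\<^sub>0 = 16 + 32 * Lmax * (1 + exp 2) + 1792 * (1 + exp (- 2)) * Lmax\<^sup>2"
    and "\<beta> = \<beta>\<^sub>0 * sqrt \<beta>\<^sub>1 + Lmax"
    and "C = 10 * Lmax\<^sup>2 + 2 * \<beta>"
  shows "measure M {\<omega> \<in> space M.
           spectral_norm (adjacency_matrix L H \<omega> - matrix_expectation M (adjacency_matrix L H))
             \<le> C * sqrt (total_max_degree L Q)}
         \<ge> 1 - 2 / real CARD('n) ^ 10 - 2 * exp (- real CARD('n))"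
proof (cases "CARD('n) \<ge> 2")
  case True
  interpret inhomogeneous_ER_hypergraph M L Q H by fact
  show ?thesis
    using spectral_norm_whp[OF True assms(2,3), of \<beta>\<^sub>1] assms(4-9) by simp
next
  case False
  \<comment> \<open>For N = 1 the quantity \<open>total_max_degree L Q\<close> vanishes and the
    argument for positive values breaks down, but then the claimed probability is negative.\<close>
  then have "CARD('n) = 1" using zero_less_card_finite[where 'a = 'n] by linarith
  then have "2 / real CARD('n) ^ 10 = 2" by simp
  then have "1 - 2 / real CARD('n) ^ 10 - 2 * exp (- real CARD('n)) \<le> 0"
    using exp_gt_zero[of "- real CARD('n)"] by linarith
  then show ?thesis by (rule order_trans) (rule measure_nonneg)
qed

end
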